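(* Let $G$ and $H$ be nonempty finite graphs with $\chi_{v}(G) = \chi_{v}(H)$. Consider the statements: (1) Both $G$ and $H$ admit connected strictly complementary dual solutions. (2) Every optimal vector coloring of $G \times H$ is a convex combination of optimal vector colorings induced by the factors. (3) Both skeletons $G^{\mathrm{sk}}$ and $H^{\mathrm{sk}}$ are connected. Then $(1) \Rightarrow (2) \Rightarrow (3)$.
   Context: A graph is nonempty if it has at least one edge. A vector $t$-coloring ($t\ge1$ real) of a graph assigns real vectors $p_i$ to vertices with $p_i^Tp_i=t-1$ and $p_i^Tp_j\le-1$ for $i\sim j$; $\chi_v$ is the least such $t$; vector $\chi_v$-colorings are optimal. $\rk(G)$ is the maximum of $\dim\operatorname{span}\{p_i\}$ over optimal vector colorings. The dual program for $\chi_v(G)$ maximizes $\operatorname{sum}(B)$ over symmetric $B$ indexed by $V(G)$ with $B_{ij}=0$ whenever $i\ne j$ are non-adjacent, $B\ge0$ entrywise, $\operatorname{tr}(B)=1$, $B\succeq0$; its optimum is $\chi_v(G)$. A strictly complementary dual solution is an optimal $B$ with $\dim\ker B=\rk(G)$; $B$ is connected if the graph on its indices with $i\ne j$ adjacent iff $B_{ij}\ne0$ is connected. The skeleton $G^{\mathrm{sk}}$ is the spanning subgraph of $G$ of edges $ij$ with $p_i^Tp_j=-1$ in every optimal vector coloring $\mathbf{p}$. The categorical product $G\times H$ has vertex set $V(G)\times V(H)$ with $(i,\ell)\sim(j,k)$ iff $i\sim j$ and $\ell\sim k$. A convex combination of optimal vector colorings induced by the factors is a vector coloring of $G\times H$ with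 Gram matrix $\alpha(M\otimes J)+\beta(J\otimes N)$, $M,N$ Gram matrices of optimal vector colorings of $G,H$, $J$ all-ones, $\alpha,\beta\ge0$, $\alpha+\beta=1$. *)

theory Defs
  imports "HOL-Analysis.Analysis" "HOL-Analysis.Finite_Function_Topology"
begin

section \<open>Finite simple graphs\<close>

text \<open>A finite simple graph is given by its adjacency relation; the vertex set is
  the whole (finite) type.\<close>

definition simple_graph :: "('a::finite \<Rightarrow> 'a \<Rightarrow> bool) \<Rightarrow> bool" where
  "simple_graph G \<longleftrightarrow> symp G \<and> irreflp G"

definition nonempty_graph :: "('a::finite \<Rightarrow> 'a \<Rightarrow> bool) \<Rightarrow> bool" where
  "nonempty_graph G \<longleftrightarrow> (\<exists>i j. G i j)"

definition connected_graph :: "('a::finite \<Rightarrow> 'a \<Rightarrow> bool) \<Rightarrow> bool" where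
  "connected_graph G \<longleftrightarrow> (\<forall>i j. G\<^sup>*\<^sup>* i j)"

definition categorical_product ::
    "('a::finite \<Rightarrow> 'a \<Rightarrow> bool) \<Rightarrow> ('b::finite \<Rightarrow> 'b \<Rightarrow> bool) \<Rightarrow> 'a \<times> 'b \<Rightarrow> 'a \<times> 'b \<Rightarrow> bool" where
  "categorical_product G H = (\<lambda>(i, l) (j, k). G i j \<and> H l k)"


section \<open>Vector colorings\<close>

text \<open>Real vectors of arbitrary finite dimension are modelled as finitely supported real
  sequences: the union of all \<open>\<real>\<^sup>d\<close>, where \<open>\<real>\<^sup>d\<close> consists of the sequences supported in
  \<open>{..<d}\<close>. Any coloring of a finite graph uses vectors of a common \<open>\<real>\<^sup>d\<close>, and \<open>d\<close> is
  unrestricted. The library norm on this type is the \<open>\<ell>\<^sup>1\<close> norm and is not used here;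
  the inner product is the standard one.\<close>

type_synonym rvec = "nat \<Rightarrow>\<^sub>0 real"

definition vec_inner :: "rvec \<Rightarrow> rvec \<Rightarrow> real" where
  "vec_inner x y = (\<Sum>k\<in>Poly_Mapping.keys x. Poly_Mapping.lookup x k * Poly_Mapping.lookup y k)"

definition vector_coloring :: "('a::finite \<Rightarrow> 'a \<Rightarrow> bool) \<Rightarrow> real \<Rightarrow> ('a \<Rightarrow> rvec) \<Rightarrow> bool" where
  "vector_coloring G t p \<longleftrightarrow> t \<ge> 1 \<and>
     (\<forall>i. vec_inner (p i) (p i) = t - 1) \<and>
     (\<forall>i j. G i j \<longrightarrow> vec_inner (p i) (p j) \<le> -1)"

definition vector_chromatic_number :: "('a::finite \<Rightarrow> 'a \<Rightarrow> bool) \<Rightarrow> real" where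
  "vector_chromatic_number G = (LEAST t. \<exists>p. vector_coloring G t p)"

definition optimal_vector_coloring :: "('a::finite \<Rightarrow> 'a \<Rightarrow> bool) \<Rightarrow> ('a \<Rightarrow> rvec) \<Rightarrow> bool" where
  "optimal_vector_coloring G p \<longleftrightarrow> vector_coloring G (vector_chromatic_number G) p"

definition coloring_rank :: "('a::finite \<Rightarrow> 'a \<Rightarrow> bool) \<Rightarrow> nat" where
  "coloring_rank G = Max {dim (span (range p)) | p. optimal_vector_coloring G p}"

definition skeleton :: "('a::finite \<Rightarrow> 'a \<Rightarrow> bool) \<Rightarrow> 'a \<Rightarrow> 'a \<Rightarrow> bool" where
  "skeleton G i j \<longleftrightarrow> G i j \<and>
     (\<forall>p. optimal_vector_coloring G p \<longrightarrow> vec_inner (p i) (p j) = -1)"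


section \<open>The dual program\<close>

definition psd_matrix :: "real^'a^'a \<Rightarrow> bool" where
  "psd_matrix B \<longleftrightarrow> transpose B = B \<and> (\<forall>x. 0 \<le> x \<bullet> (B *v x))"

definition sum_entries :: "real^'a^'a \<Rightarrow> real" where
  "sum_entries B = (\<Sum>i\<in>UNIV. \<Sum>j\<in>UNIV. B $ i $ j)"

definition dual_feasible :: "('a::finite \<Rightarrow> 'a \<Rightarrow> bool) \<Rightarrow> real^'a^'a \<Rightarrow> bool" where
  "dual_feasible G B \<longleftrightarrow>
     (\<forall>i j. i \<noteq> j \<and> \<not> G i j \<longrightarrow> B $ i $ j = 0) \<and>
     (\<forall>i j. 0 \<le> B $ i $ j) \<and> trace B = 1 \<and> psd_matrix B"

definition dual_optimal :: "('a::finite \<Rightarrow> 'a \<Rightarrow> bool) \<Rightarrow> real^'a^'a \<Rightarrow> bool" where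
  "dual_optimal G B \<longleftrightarrow> dual_feasible G B \<and>
     (\<forall>C. dual_feasible G C \<longrightarrow> sum_entries C \<le> sum_entries B)"

definition strictly_complementary :: "('a::finite \<Rightarrow> 'a \<Rightarrow> bool) \<Rightarrow> real^'a^'a \<Rightarrow> bool" where
  "strictly_complementary G B \<longleftrightarrow>
     dual_optimal G B \<and> dim {x. B *v x = 0} = coloring_rank G"

definition connected_matrix :: "real^'a^'a \<Rightarrow> bool" where
  "connected_matrix B \<longleftrightarrow> connected_graph (\<lambda>i j. i \<noteq> j \<and> B $ i $ j \<noteq> 0)"


section \<open>Colorings of the product induced by the factors\<close>

definition gram :: "('a::finite \<Rightarrow> rvec) \<Rightarrow> real^'a^'a" where
  "gram p = (\<chi> i j. vec_inner (p i) (p j))"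

definition kronecker :: "real^'a^'a \<Rightarrow> real^'b^'b \<Rightarrow> real^('a \<times> 'b)^('a \<times> 'b)" where
  "kronecker M N = (\<chi> x y. M $ fst x $ fst y * N $ snd x $ snd y)"

definition all_ones :: "real^'a^'a" where
  "all_ones = (\<chi> i j. 1)"

definition convex_combination_of_induced ::
    "('a::finite \<Rightarrow> 'a \<Rightarrow> bool) \<Rightarrow> ('b::finite \<Rightarrow> 'b \<Rightarrow> bool) \<Rightarrow> ('a \<times> 'b \<Rightarrow> rvec) \<Rightarrow> bool" where
  "convex_combination_of_induced G H p \<longleftrightarrow>
     (\<exists>t. vector_coloring (categorical_product G H) t p) \<and>
     (\<exists>\<alpha> \<beta> q r. 0 \<le> \<alpha> \<and> 0 \<le> \<beta> \<and> \<alpha> + \<beta> = 1 \<and>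
        optimal_vector_coloring G q \<and> optimal_vector_coloring H r \<and>
        gram p = \<alpha> *\<^sub>R kronecker (gram q) all_ones + \<beta> *\<^sub>R kronecker all_ones (gram r))"

end

theory Submission
  imports Defs
begin

text \<open>For (1) to (2), complementary slackness gives a dual solution the row sums
  \<open>\<Sum>\<^sub>j B\<^sub>i\<^sub>j = \<chi>\<^sub>v B\<^sub>i\<^sub>i\<close>, so \<open>B\<close> determines a weighted Laplacian on its support. Dual
  solutions of the factors combine to one of the product, and a Laplacian term in it forces
  \<open>p\<^sub>i\<^sub>l = a\<^sub>i + b\<^sub>l\<close> for every optimal coloring \<open>p\<close> of the product when both supports are connected;
  since all \<open>p\<^sub>i\<^sub>l\<close> have the same norm, the \<open>a\<^sub>i\<close> are orthogonal to the \<open>b\<^sub>l\<close>.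

  For (2) to (3), an induced coloring may use different weights on the two sides of a cut of \<open>G\<close>
  containing no skeleton edge, because some optimal coloring has slack on every edge of the cut.\<close>

section \<open>The inner product on finitely supported sequences\<close>

text \<open>Colorings live in unbounded dimension, but their Gram matrices lie in a
  finite-dimensional space where compactness and separation apply; a Cholesky factorisation leads
  back to vectors. Optimality of \<open>B\<close> only compares it with other feasible matrices.
  Strong duality is what ties its value to the chromatic number and makes the slackness terms
  vanish. Equality of the two chromatic numbers lets a single \<open>t\<close> enter both row sum
  identities, so that both factors yield Laplacians in one identity. The summands \<open>a\<close>
  and \<open>b\<close> are averages of \<open>p\<close> with the diagonals of \<open>C\<close> and
  \<open>B\<close> as weights. These weights have total 1 and are proportional to the column sums,
  so \<open>a\<close> and \<open>b\<close> are annihilated by \<open>B\<close> and \<open>C\<close>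
  and have weighted mean zero. The mean removes the cross terms, and the annihilation fixes the
  norms. Conversely, (2) itself yields the chromatic number of the product, so the coloring built
  from a cut is optimal and has to be induced.\<close>

lemma vec_inner_superset:
  assumes "finite K" and "Poly_Mapping.keys x \<subseteq> K"
  shows "vec_inner x y = (\<Sum>k\<in>K. Poly_Mapping.lookup x k * Poly_Mapping.lookup y k)"
  unfolding vec_inner_def
  by (rule sum.mono_neutral_left) (use assms in \<open>auto simp: in_keys_iff\<close>)

lemma lookup_scaleR: "Poly_Mapping.lookup (c *\<^sub>R x) k = c * Poly_Mapping.lookup (x :: rvec) k"
proof -
  have "finite {i. c *\<^sub>R Poly_Mapping.lookup x i \<noteq> 0}"
    by (rule finite_subset[of _ "Poly_Mapping.keys x"]) (auto simp: in_keys_iff)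
  then show ?thesis
    by (simp add: scaleR_poly_mapping_def)
qed

lemma vec_inner_commute: "vec_inner x y = vec_inner y x"
  using vec_inner_superset[of "Poly_Mapping.keys x \<union> Poly_Mapping.keys y" x y]
    vec_inner_superset[of "Poly_Mapping.keys x \<union> Poly_Mapping.keys y" y x]
  by (simp add: mult.commute)

lemma vec_inner_add_left: "vec_inner (x + y) z = vec_inner x z + vec_inner y z"
proof -
  let ?K = "Poly_Mapping.keys x \<union> Poly_Mapping.keys y"
  show ?thesis
    using vec_inner_superset[of ?K x z] vec_inner_superset[of ?K y z]
      vec_inner_superset[of ?K "x + y" z] Poly_Mapping.keys_add[of x y]
    by (simp add: lookup_add algebra_simps sum.distrib)
qed

lemma vec_inner_scaleR_left: "vec_inner (c *\<^sub>R x) y = c * vec_inner x y"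
proof -
  have "Poly_Mapping.keys (c *\<^sub>R x) \<subseteq> Poly_Mapping.keys x"
    by (auto simp: in_keys_iff lookup_scaleR)
  then show ?thesis
    using vec_inner_superset[of "Poly_Mapping.keys x" "c *\<^sub>R x" y]
    by (simp add: lookup_scaleR vec_inner_def sum_distrib_left mult.assoc)
qed

lemma vec_inner_zero_left [simp]: "vec_inner 0 x = 0"
  by (simp add: vec_inner_def)

lemma vec_inner_zero_right [simp]: "vec_inner x 0 = 0"
  by (simp add: vec_inner_def)

lemma vec_inner_add_right: "vec_inner x (y + z) = vec_inner x y + vec_inner x z"
  by (metis vec_inner_add_left vec_inner_commute)

lemma vec_inner_scaleR_right: "vec_inner x (c *\<^sub>R y) = c * vec_inner x y"
  by (metis vec_inner_scaleR_left vec_inner_commute)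

lemma vec_inner_sum_left: "vec_inner (\<Sum>i\<in>A. f i) y = (\<Sum>i\<in>A. vec_inner (f i) y)"
  by (induction A rule: infinite_finite_induct) (simp_all add: vec_inner_add_left)

lemma vec_inner_sum_right: "vec_inner y (\<Sum>i\<in>A. f i) = (\<Sum>i\<in>A. vec_inner y (f i))"
  by (induction A rule: infinite_finite_induct) (simp_all add: vec_inner_add_right)

lemma vec_inner_self_nonneg: "0 \<le> vec_inner x x"
  by (simp add: vec_inner_def sum_nonneg)

lemma vec_inner_self_eq_0_iff: "vec_inner x x = 0 \<longleftrightarrow> x = 0"
proof
  assume "vec_inner x x = 0"
  then have "\<forall>k\<in>Poly_Mapping.keys x. Poly_Mapping.lookup x k * Poly_Mapping.lookup x k = 0"
    unfolding vec_inner_def by (subst (asm) sum_nonneg_eq_0_iff) auto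
  then show "x = 0"
    by (metis in_keys_iff lookup_zero mult_eq_0_iff poly_mapping_eqI)
qed simp

text \<open>A common finite set of coordinates turns statements about the family into finitely many
  scalar ones.\<close>

lemma vec_inner_components:
  fixes p :: "'i::finite \<Rightarrow> rvec"
  shows "\<exists>N. finite N \<and> (\<forall>i. Poly_Mapping.keys (p i) \<subseteq> N) \<and> (\<forall>i y. vec_inner (p i) y =
    (\<Sum>k\<in>N. Poly_Mapping.lookup (p i) k * Poly_Mapping.lookup y k))"
proof (intro exI conjI allI)
  let ?N = "\<Union>i. Poly_Mapping.keys (p i)"
  show "finite ?N" by simp
  then show "vec_inner (p i) y = (\<Sum>k\<in>?N. Poly_Mapping.lookup (p i) k * Poly_Mapping.lookup y k)"
    for i y by (rule vec_inner_superset) auto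
qed auto


section \<open>Positive semidefinite kernels\<close>

text \<open>Two-argument functions replace matrices here because reindexing along \<open>fst\<close>
  or \<open>snd\<close> and entrywise products are then plain lambda terms.\<close>

definition quad_form :: "('i::finite \<Rightarrow> 'i \<Rightarrow> real) \<Rightarrow> ('i \<Rightarrow> real) \<Rightarrow> real" where
  "quad_form K f = (\<Sum>i\<in>UNIV. \<Sum>j\<in>UNIV. f i * K i j * f j)"

definition psd_kernel :: "('i::finite \<Rightarrow> 'i \<Rightarrow> real) \<Rightarrow> bool" where
  "psd_kernel K \<longleftrightarrow> (\<forall>i j. K i j = K j i) \<and> (\<forall>f. 0 \<le> quad_form K f)"

lemma psd_kernelI:
  assumes "\<And>i j. K i j = K j i" and "\<And>f. 0 \<le> quad_form K f"
  shows "psd_kernel K"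
  using assms unfolding psd_kernel_def by blast

lemma psd_kernel_eqI: "psd_kernel K \<Longrightarrow> (\<And>i j. L i j = K i j) \<Longrightarrow> psd_kernel L"
  by (simp add: psd_kernel_def quad_form_def)

lemma psd_kernel_sym: "psd_kernel K \<Longrightarrow> K i j = K j i"
  unfolding psd_kernel_def by blast

lemma psd_kernel_quad_form_nonneg: "psd_kernel K \<Longrightarrow> 0 \<le> quad_form K f"
  unfolding psd_kernel_def by blast

lemma psd_matrix_iff_psd_kernel: "psd_matrix B \<longleftrightarrow> psd_kernel (\<lambda>i j. B $ i $ j)"
proof -
  have form: "x \<bullet> (B *v x) = quad_form (\<lambda>i j. B $ i $ j) (($) x)" for x
    by (simp add: inner_vec_def matrix_vector_mult_def quad_form_def sum_distrib_left mult.assoc)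
  have "(\<forall>x. 0 \<le> x \<bullet> (B *v x)) \<longleftrightarrow> (\<forall>f. 0 \<le> quad_form (\<lambda>i j. B $ i $ j) f)"
  proof (intro iffI allI)
    fix f assume "\<forall>x. 0 \<le> x \<bullet> (B *v x)"
    from this[rule_format, of "vec_lambda f"] show "0 \<le> quad_form (\<lambda>i j. B $ i $ j) f"
      by (simp add: form vec_lambda_inverse)
  qed (simp add: form)
  moreover have "transpose B = B \<longleftrightarrow> (\<forall>i j. B $ i $ j = B $ j $ i)"
    by (auto simp: transpose_def vec_eq_iff)
  ultimately show ?thesis
    unfolding psd_matrix_def psd_kernel_def by simp
qed

lemma psd_kernel_add:
  assumes "psd_kernel K" and "psd_kernel L"
  shows "psd_kernel (\<lambda>i j. K i j + L i j)"
proof (rule psd_kernelI)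
  show "0 \<le> quad_form (\<lambda>i j. K i j + L i j) f" for f
    using psd_kernel_quad_form_nonneg[OF assms(1), of f] psd_kernel_quad_form_nonneg[OF assms(2), of f]
    by (simp add: quad_form_def algebra_simps sum.distrib)
qed (use assms in \<open>simp add: psd_kernel_sym\<close>)

lemma psd_kernel_scale:
  assumes "psd_kernel K" and "0 \<le> c"
  shows "psd_kernel (\<lambda>i j. c * K i j)"
proof (rule psd_kernelI)
  fix f
  have "quad_form (\<lambda>i j. c * K i j) f = c * quad_form K f"
    by (simp add: quad_form_def sum_distrib_left algebra_simps)
  then show "0 \<le> quad_form (\<lambda>i j. c * K i j) f"
    using assms by (simp add: psd_kernel_quad_form_nonneg)
qed (metis assms(1) psd_kernel_sym)

lemma quad_form_gram:
  "quad_form (\<lambda>i j. vec_inner (p i) (p j)) f =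
     vec_inner (\<Sum>i\<in>UNIV. f i *\<^sub>R p i) (\<Sum>i\<in>UNIV. f i *\<^sub>R p i)"
  by (simp add: quad_form_def vec_inner_sum_left vec_inner_sum_right vec_inner_scaleR_left
      vec_inner_scaleR_right sum_distrib_left mult_ac vec_inner_commute)

lemma psd_kernel_gram: "psd_kernel (\<lambda>i j. vec_inner (p i) (p j))"
  by (rule psd_kernelI) (simp_all add: vec_inner_commute quad_form_gram vec_inner_self_nonneg)

lemma psd_kernel_rank_one: "psd_kernel (\<lambda>i j. f i * f j)"
proof (rule psd_kernelI)
  fix g
  have "quad_form (\<lambda>i j. f i * f j) g = (\<Sum>i\<in>UNIV. f i * g i)\<^sup>2"
    by (simp add: quad_form_def power2_eq_square sum_product mult_ac)
  then show "0 \<le> quad_form (\<lambda>i j. f i * f j) g" by simp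
qed simp

text \<open>Serves both the two-point test vectors and the completion of the square in the Cholesky
  step.\<close>

lemma quad_form_add_single:
  assumes sym: "\<And>i j. K i j = K j i"
  shows "quad_form K (\<lambda>i. f i + (if i = a then c else 0)) =
    quad_form K f + 2 * c * (\<Sum>j\<in>UNIV. K a j * f j) + c\<^sup>2 * K a a"
proof -
  let ?d = "\<lambda>i. if i = a then c else 0"
  have "quad_form K (\<lambda>i. f i + ?d i) = quad_form K f
      + (\<Sum>i\<in>UNIV. \<Sum>j\<in>UNIV. ?d i * K i j * f j) + (\<Sum>i\<in>UNIV. \<Sum>j\<in>UNIV. f i * K i j * ?d j)
      + (\<Sum>i\<in>UNIV. \<Sum>j\<in>UNIV. ?d i * K i j * ?d j)"
    unfolding quad_form_def by (simp only: distrib_left distrib_right sum.distrib add_ac)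
  moreover have "(\<Sum>i\<in>UNIV. \<Sum>j\<in>UNIV. ?d i * K i j * f j) = c * (\<Sum>j\<in>UNIV. K a j * f j)"
  proof -
    have "(\<Sum>j\<in>UNIV. ?d i * K i j * f j) = (if i = a then c * (\<Sum>j\<in>UNIV. K a j * f j) else 0)" for i
      by (simp add: sum_distrib_left mult.assoc)
    then show ?thesis by simp
  qed
  moreover have "(\<Sum>i\<in>UNIV. \<Sum>j\<in>UNIV. f i * K i j * ?d j) = c * (\<Sum>j\<in>UNIV. K a j * f j)"
    by (simp add: if_distrib sum_distrib_left sym[of _ a] mult_ac cong: if_cong)
  moreover have "(\<Sum>i\<in>UNIV. \<Sum>j\<in>UNIV. ?d i * K i j * ?d j) = c\<^sup>2 * K a a"
  proof -
    have "(\<Sum>j\<in>UNIV. ?d i * K i j * ?d j) = (if i = a then c\<^sup>2 * K a a else 0)" for i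
      by (simp add: if_distrib power2_eq_square mult_ac cong: if_cong)
    then show ?thesis by simp
  qed
  ultimately show ?thesis by simp
qed

lemma quad_form_two_points:
  assumes sym: "\<And>i j. K i j = K j i"
  shows "quad_form K (\<lambda>i. (if i = b then 1 else 0) + (if i = a then c else 0)) =
    K b b + 2 * c * K a b + c\<^sup>2 * K a a"
proof -
  have "(\<Sum>j\<in>UNIV. (if i = b then 1 else 0) * K i j * (if j = b then 1 else 0)) =
      (if i = b then K b b else 0)" for i
    by (simp add: if_distrib cong: if_cong)
  then have "quad_form K (\<lambda>i. if i = b then 1 else 0) = K b b"
    unfolding quad_form_def by simp
  then show ?thesis
    unfolding quad_form_add_single[of K, OF sym] by (simp add: if_distrib cong: if_cong)
qed


lemma psd_kernel_abs_le:
  assumes "psd_kernel K"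
  shows "2 * \<bar>K a b\<bar> \<le> K a a + K b b"
proof -
  note two = quad_form_two_points[of K, OF psd_kernel_sym[OF assms]]
  have "0 \<le> K b b + 2 * c * K a b + c\<^sup>2 * K a a" for c
    using psd_kernel_quad_form_nonneg[OF assms] unfolding two[symmetric] .
  from this[of 1] this[of "-1"] show ?thesis by simp
qed

lemma psd_kernel_diag_nonneg:
  assumes "psd_kernel K"
  shows "0 \<le> K a a"
  using psd_kernel_abs_le[OF assms, of a a] by linarith

lemma psd_kernel_zero_diag:
  assumes "psd_kernel K" and "K a a = 0"
  shows "K a b = 0"
proof (rule ccontr)
  assume nz: "K a b \<noteq> 0"
  note two = quad_form_two_points[of K, OF psd_kernel_sym[OF assms(1)]]
  have "0 \<le> K b b + 2 * c * K a b + c\<^sup>2 * K a a" for c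
    using psd_kernel_quad_form_nonneg[OF assms(1)] unfolding two[symmetric] .
  \<comment> \<open>With \<open>K a a = 0\<close> the form is affine in \<open>c\<close>, with
    nonzero slope; this \<open>c\<close> gives it the value -1.\<close>
  from this[of "- (K b b + 1) / (2 * K a b)"] nz assms(2) show False by (simp add: field_simps)
qed

text \<open>Cholesky factorisation: pivoting at an index with positive diagonal entry leaves the Schur
  complement, which is again positive semidefinite and vanishes on that index.\<close>

lemma psd_kernel_factorization_on:
  fixes K :: "'i::finite \<Rightarrow> 'i \<Rightarrow> real"
  assumes "finite S" and "psd_kernel K" and "\<And>i j. i \<notin> S \<Longrightarrow> K i j = 0"
  shows "\<exists>p N. (\<forall>i j. vec_inner (p i) (p j) = K i j) \<and>
    (\<forall>i. Poly_Mapping.keys (p i) \<subseteq> {..<N::nat})"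
  using assms
proof (induction S arbitrary: K rule: finite_induct)
  case empty
  then show ?case by (intro exI[of _ "\<lambda>_. 0"] exI[of _ 0]) simp
next
  case (insert a S)
  note sym = psd_kernel_sym[OF insert.prems(1)]
  show ?case
  proof (cases "K a a = 0")
    case True
    then have "K i j = 0" if "i \<notin> S" for i j
      using that insert.prems(2)[of i j] psd_kernel_zero_diag[OF insert.prems(1)] by (cases "i = a") auto
    then show ?thesis using insert.IH insert.prems(1) by blast
  next
    case False
    then have pos: "0 < K a a"
      using psd_kernel_diag_nonneg[OF insert.prems(1), of a] by simp
    define K' where "K' i j = K i j - K a i * K a j / K a a" for i j
    have "psd_kernel K'"
    proof (rule psd_kernelI)
      fix f
      define s where "s = (\<Sum>j\<in>UNIV. K a j * f j)"
      \<comment> \<open>The shift of coordinate \<open>a\<close> by \<open>- s / K a a\<close>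
        minimises the form in that coordinate, and the minimum is the form of the Schur
        complement.\<close>
      have "0 \<le> quad_form K (\<lambda>i. f i + (if i = a then - s / K a a else 0))"
        by (rule psd_kernel_quad_form_nonneg[OF insert.prems(1)])
      also have "\<dots> = quad_form K f - s * s / K a a"
        unfolding quad_form_add_single[of K, OF sym] s_def[symmetric]
        using pos by (simp add: power2_eq_square field_simps)
      also have "s * s / K a a = (\<Sum>i\<in>UNIV. \<Sum>j\<in>UNIV. f i * (K a i * K a j / K a a) * f j)"
        unfolding s_def sum_product sum_divide_distrib by (simp add: mult_ac)
      also have "quad_form K f - \<dots> = quad_form K' f"
        by (simp add: quad_form_def K'_def algebra_simps sum_subtractf)
      finally show "0 \<le> quad_form K' f" .
    qed (metis K'_def mult.commute sym)
    moreover have "K' i j = 0" if "i \<notin> S" for i j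
      using that insert.prems(2)[of i] False sym[of a i] by (cases "i = a") (auto simp: K'_def)
    ultimately obtain p N where p: "\<And>i j. vec_inner (p i) (p j) = K' i j"
      and N: "\<And>i. Poly_Mapping.keys (p i) \<subseteq> {..<N}"
      using insert.IH by blast
    \<comment> \<open>Coordinate \<open>N\<close> lies outside the support of every
      \<open>p i\<close>, so it contributes exactly the pivot term. The bound on keys is carried
      through the induction to provide this fresh coordinate.\<close>
    define q where "q i = p i + Poly_Mapping.single N (K a i / sqrt (K a a))" for i
    have pN: "Poly_Mapping.lookup (p i) N = 0" for i
      using N[of i] by (metis in_keys_iff lessThan_iff less_irrefl subsetD)
    have "vec_inner (Poly_Mapping.single N c) y = c * Poly_Mapping.lookup y N" for c and y :: rvec
      by (simp add: vec_inner_def)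
    then have "vec_inner (q i) (q j) = K' i j + (K a i / sqrt (K a a)) * (K a j / sqrt (K a a))" for i j
      unfolding q_def vec_inner_add_left vec_inner_add_right p
        vec_inner_commute[of "p i" "Poly_Mapping.single N _"]
      by (simp add: pN lookup_add)
    moreover have "(x / sqrt (K a a)) * (y / sqrt (K a a)) = x * y / K a a" for x y
      using pos by simp
    ultimately have "vec_inner (q i) (q j) = K i j" for i j
      by (simp add: K'_def)
    moreover have "Poly_Mapping.keys (q i) \<subseteq> {..<Suc N}" for i
    proof
      fix k assume "k \<in> Poly_Mapping.keys (q i)"
      then have "k \<in> Poly_Mapping.keys (p i) \<or> k = N"
        using Poly_Mapping.keys_add[of "p i" "Poly_Mapping.single N (K a i / sqrt (K a a))"]
        unfolding q_def by (auto split: if_splits)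
      then show "k \<in> {..<Suc N}" using N[of i] by auto
    qed
    ultimately show ?thesis by blast
  qed
qed

lemma psd_kernel_factorization:
  assumes "psd_kernel K"
  obtains p where "\<And>i j. vec_inner (p i) (p j) = K i j"
  using psd_kernel_factorization_on[of UNIV K] assms by auto

text \<open>Schur product theorem: splitting \<open>L\<close> into rank-one kernels, one per
  coordinate of a factorisation, writes the form of the product as a sum of forms of
  \<open>K\<close>.\<close>

lemma psd_kernel_mult:
  assumes "psd_kernel K" and "psd_kernel L"
  shows "psd_kernel (\<lambda>i j. K i j * L i j)"
proof (rule psd_kernelI)
  fix f
  obtain p where p: "\<And>i j. vec_inner (p i) (p j) = L i j"
    using psd_kernel_factorization[OF assms(2)] by blast
  obtain N where N: "finite N" "\<And>i y. vec_inner (p i) y =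
      (\<Sum>k\<in>N. Poly_Mapping.lookup (p i) k * Poly_Mapping.lookup y k)"
    using vec_inner_components[of p] by blast
  have "quad_form (\<lambda>i j. K i j * L i j) f =
      (\<Sum>k\<in>N. quad_form K (\<lambda>i. f i * Poly_Mapping.lookup (p i) k))"
    unfolding quad_form_def p[symmetric] N(2) sum_distrib_left sum_distrib_right
    by (subst sum.swap[of _ N], subst sum.swap[of _ N]) (simp add: mult_ac)
  then show "0 \<le> quad_form (\<lambda>i j. K i j * L i j) f"
    by (simp add: sum_nonneg psd_kernel_quad_form_nonneg[OF assms(1)])
qed (metis assms psd_kernel_sym)

text \<open>Since \<open>h\<close> may be non-injective, \<open>fst\<close> and \<open>snd\<close>
  lift kernels of the factors to the product; together with \<open>psd_kernel_mult\<close> this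
  handles Kronecker products.\<close>

lemma psd_kernel_comp:
  assumes "psd_kernel K"
  shows "psd_kernel (\<lambda>x y. K (h x) (h y))"
proof -
  obtain p where "\<And>i j. vec_inner (p i) (p j) = K i j"
    using psd_kernel_factorization[OF assms] by blast
  then show ?thesis
    using psd_kernel_gram[of "\<lambda>x. p (h x)"] by simp
qed

text \<open>In a factorisation the form at \<open>f\<close> is the squared norm of a combination of
  the vectors, so that combination is zero.\<close>

lemma psd_kernel_null:
  assumes "psd_kernel K" and "quad_form K f = 0"
  shows "(\<Sum>j\<in>UNIV. K i j * f j) = 0"
proof -
  obtain p where p: "\<And>i j. vec_inner (p i) (p j) = K i j"
    using psd_kernel_factorization[OF assms(1)] by blast
  have "(\<Sum>j\<in>UNIV. f j *\<^sub>R p j) = 0"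
    using assms(2) quad_form_gram[of p f] by (simp add: p vec_inner_self_eq_0_iff)
  then have "vec_inner (p i) (\<Sum>j\<in>UNIV. f j *\<^sub>R p j) = 0" by simp
  then show ?thesis
    by (simp add: vec_inner_sum_right vec_inner_scaleR_right p mult.commute)
qed

text \<open>The pairing of a kernel with a Gram matrix splits over coordinates. The clause on keys
  disposes of the coordinates outside \<open>N\<close> in
  \<open>trace_gram_eq_0_imp_null\<close>.\<close>

lemma trace_gram_eq_sum_quad_form:
  fixes p :: "'i::finite \<Rightarrow> rvec"
  shows "\<exists>N. finite N \<and> (\<forall>i. Poly_Mapping.keys (p i) \<subseteq> N) \<and>
    (\<forall>K. (\<Sum>i\<in>UNIV. \<Sum>j\<in>UNIV. K i j * vec_inner (p i) (p j)) =
      (\<Sum>k\<in>N. quad_form K (\<lambda>i. Poly_Mapping.lookup (p i) k)))"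
proof -
  obtain N where N: "finite N" "\<forall>i. Poly_Mapping.keys (p i) \<subseteq> N"
    and inner: "\<And>i y. vec_inner (p i) y =
      (\<Sum>k\<in>N. Poly_Mapping.lookup (p i) k * Poly_Mapping.lookup y k)"
    using vec_inner_components[of p] by blast
  have "(\<Sum>i\<in>UNIV. \<Sum>j\<in>UNIV. K i j * vec_inner (p i) (p j)) =
      (\<Sum>k\<in>N. quad_form K (\<lambda>i. Poly_Mapping.lookup (p i) k))" for K
    unfolding quad_form_def inner sum_distrib_left sum_distrib_right
    by (subst sum.swap[of _ N], subst sum.swap[of _ N]) (simp add: mult_ac)
  with N show ?thesis by blast
qed

lemma trace_gram_nonneg:
  assumes "psd_kernel K"
  shows "0 \<le> (\<Sum>i\<in>UNIV. \<Sum>j\<in>UNIV. K i j * vec_inner (p i) (p j))"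
proof -
  obtain N where "\<And>K. (\<Sum>i\<in>UNIV. \<Sum>j\<in>UNIV. K i j * vec_inner (p i) (p j)) =
      (\<Sum>k\<in>N. quad_form K (\<lambda>i. Poly_Mapping.lookup (p i) k))"
    using trace_gram_eq_sum_quad_form[of p] by blast
  then show ?thesis
    by (simp add: sum_nonneg psd_kernel_quad_form_nonneg[OF assms])
qed

text \<open>A vanishing sum of nonnegative forms makes every coordinate of \<open>p\<close> a null
  vector of \<open>K\<close>. This is the form in which complementary slackness is used.\<close>

lemma trace_gram_eq_0_imp_null:
  fixes p :: "'i::finite \<Rightarrow> rvec"
  assumes "psd_kernel K" and "(\<Sum>i\<in>UNIV. \<Sum>j\<in>UNIV. K i j * vec_inner (p i) (p j)) = 0"
  shows "(\<Sum>j\<in>UNIV. K i j *\<^sub>R p j) = 0"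
proof (rule poly_mapping_eqI)
  fix k
  obtain N where N: "finite N" "\<And>i. Poly_Mapping.keys (p i) \<subseteq> N"
    and eq: "\<And>K. (\<Sum>i\<in>UNIV. \<Sum>j\<in>UNIV. K i j * vec_inner (p i) (p j)) =
      (\<Sum>k\<in>N. quad_form K (\<lambda>i. Poly_Mapping.lookup (p i) k))"
    using trace_gram_eq_sum_quad_form[of p] by blast
  have "(\<Sum>j\<in>UNIV. K i j * Poly_Mapping.lookup (p j) k) = 0"
  proof (cases "k \<in> N")
    case True
    have "(\<Sum>k\<in>N. quad_form K (\<lambda>i. Poly_Mapping.lookup (p i) k)) = 0"
      using assms(2) eq by simp
    then have "quad_form K (\<lambda>i. Poly_Mapping.lookup (p i) k) = 0"
      using True N(1) psd_kernel_quad_form_nonneg[OF assms(1)] by (subst (asm) sum_nonneg_eq_0_iff) auto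
    then show ?thesis by (rule psd_kernel_null[OF assms(1)])
  next
    case False
    then have "Poly_Mapping.lookup (p j) k = 0" for j
      using N(2)[of j] by (metis in_keys_iff subsetD)
    then show ?thesis by simp
  qed
  then show "Poly_Mapping.lookup (\<Sum>j\<in>UNIV. K i j *\<^sub>R p j) k = Poly_Mapping.lookup 0 k"
    by (simp add: lookup_sum lookup_scaleR)
qed


section \<open>Existence of optimal vector colorings\<close>

text \<open>Removes the dimension of the vectors: the search for colorings becomes one over matrices
  of fixed size.\<close>

lemma vector_coloring_iff_psd_kernel:
  "(\<exists>p. vector_coloring G t p) \<longleftrightarrow> t \<ge> 1 \<and>
    (\<exists>M. psd_kernel M \<and> (\<forall>i. M i i = t - 1) \<and> (\<forall>i j. G i j \<longrightarrow> M i j \<le> -1))"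
  (is "?L \<longleftrightarrow> ?R")
proof
  assume ?L
  then obtain p where "vector_coloring G t p" ..
  then show ?R
    unfolding vector_coloring_def
    by (auto intro!: exI[of _ "\<lambda>i j. vec_inner (p i) (p j)"] psd_kernel_gram)
next
  assume ?R
  then obtain M where M: "t \<ge> 1" "psd_kernel M" "\<forall>i. M i i = t - 1" "\<forall>i j. G i j \<longrightarrow> M i j \<le> -1"
    by blast
  obtain p where "\<And>i j. vec_inner (p i) (p j) = M i j"
    using psd_kernel_factorization[OF M(2)] by blast
  with M show ?L
    unfolding vector_coloring_def by (intro exI[of _ p]) simp
qed

text \<open>The Gram matrix of a regular simplex, which colors every irreflexive graph with
  \<open>t\<close> equal to the number of vertices. Positivity is Cauchy-Schwarz.\<close>

lemma psd_kernel_simplex: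
  "psd_kernel (\<lambda>(i::'a::finite) j. (if i = j then real CARD('a) else 0) - 1)"
proof (rule psd_kernelI)
  fix f :: "'a \<Rightarrow> real"
  have "(\<Sum>j\<in>UNIV. f i * ((if i = j then real CARD('a) else 0) - 1) * f j) =
      real CARD('a) * (f i)\<^sup>2 - f i * (\<Sum>j\<in>UNIV. f j)" for i
  proof -
    have "(\<Sum>j\<in>UNIV. f i * ((if i = j then real CARD('a) else 0) - 1) * f j) =
      (\<Sum>j\<in>UNIV. (if i = j then real CARD('a) * (f i)\<^sup>2 else 0) - f i * f j)"
      by (intro sum.cong) (auto simp: power2_eq_square algebra_simps)
    then show ?thesis by (simp add: sum_subtractf sum_distrib_left)
  qed
  then have "quad_form (\<lambda>i j. (if i = j then real CARD('a) else 0) - 1) f =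
      real CARD('a) * (\<Sum>i\<in>UNIV. (f i)\<^sup>2) - (\<Sum>i\<in>UNIV. f i)\<^sup>2"
    unfolding quad_form_def
    by (simp add: sum_subtractf sum_distrib_left[symmetric] sum_distrib_right[symmetric] power2_eq_square)
  moreover have "(\<Sum>i\<in>UNIV. f i)\<^sup>2 \<le> (\<Sum>i\<in>UNIV. (f i)\<^sup>2) * real CARD('a)"
    by (rule sum_squared_le_sum_of_squares)
  ultimately show "0 \<le> quad_form (\<lambda>i j. (if i = j then real CARD('a) else 0) - 1) f"
    by (simp add: mult.commute)
qed auto

lemma norm_matrix_le_sum:
  fixes A :: "real^'n^'m"
  shows "norm A \<le> (\<Sum>i\<in>UNIV. \<Sum>j\<in>UNIV. \<bar>A $ i $ j\<bar>)"
proof -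
  have "norm A \<le> (\<Sum>i\<in>UNIV. norm (A $ i))"
    unfolding norm_vec_def by (rule L2_set_le_sum) simp
  also have "\<dots> \<le> (\<Sum>i\<in>UNIV. \<Sum>j\<in>UNIV. \<bar>A $ i $ j\<bar>)"
    by (intro sum_mono norm_le_l1_cart)
  finally show ?thesis .
qed

text \<open>The \<open>LEAST\<close> over reals that defines the chromatic number is meaningful only
  if the minimum is attained.\<close>

lemma minimal_vector_coloring_exists:
  fixes G :: "'a::finite \<Rightarrow> 'a \<Rightarrow> bool"
  assumes "irreflp G"
  shows "\<exists>t p. vector_coloring G t p \<and> (\<forall>s q. vector_coloring G s q \<longrightarrow> t \<le> s)"
proof -
  fix a :: 'a
  define n where "n = real CARD('a)"
  have n: "1 \<le> n" by (simp add: n_def Suc_leI)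
  \<comment> \<open>Positivity is spelled out as inequalities so that the closedness rules apply.
    The cap \<open>n\<close> on the diagonal bounds all entries through
    \<open>psd_kernel_abs_le\<close>, and the simplex coloring respects it.\<close>
  define S where "S = {M :: real^'a^'a. ((\<forall>i j. M $ i $ j = M $ j $ i) \<and>
      (\<forall>f. 0 \<le> (\<Sum>i\<in>UNIV. \<Sum>j\<in>UNIV. f i * M $ i $ j * f j))) \<and>
      (\<forall>i. M $ i $ i = M $ a $ a) \<and> (\<forall>i j. G i j \<longrightarrow> M $ i $ j \<le> -1) \<and> M $ a $ a \<le> n}"
  have S_iff: "M \<in> S \<longleftrightarrow> psd_kernel (\<lambda>i j. M $ i $ j) \<and> (\<forall>i. M $ i $ i = M $ a $ a) \<and>
      (\<forall>i j. G i j \<longrightarrow> M $ i $ j \<le> -1) \<and> M $ a $ a \<le> n" for M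
    unfolding S_def psd_kernel_def quad_form_def by blast
  have "closed S"
    unfolding S_def
    by (intro closed_Collect_conj closed_Collect_all closed_Collect_imp open_Collect_const
        closed_Collect_le closed_Collect_eq continuous_intros)
  moreover have "bounded S"
  proof (rule boundedI)
    fix M assume "M \<in> S"
    then have "\<bar>M $ i $ j\<bar> \<le> n" for i j
      using psd_kernel_abs_le[of "\<lambda>i j. M $ i $ j" i j] unfolding S_iff
      by (smt (verit, best))
    then have "(\<Sum>i\<in>UNIV. \<Sum>j\<in>UNIV. \<bar>M $ i $ j\<bar>) \<le> (\<Sum>i\<in>(UNIV::'a set). \<Sum>j\<in>(UNIV::'a set). n)"
      by (intro sum_mono)
    then show "norm M \<le> (\<Sum>i\<in>(UNIV::'a set). \<Sum>j\<in>(UNIV::'a set). n)"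
      using norm_matrix_le_sum[of M] by linarith
  qed
  ultimately have "compact S" by (simp add: compact_eq_bounded_closed)
  moreover have M0: "(\<chi> i j. (if i = j then n else 0) - 1) \<in> S"
    using assms unfolding S_iff
    by (auto intro!: psd_kernel_eqI[OF psd_kernel_simplex] simp: n_def irreflp_def)
  moreover have "continuous_on S (\<lambda>M. M $ a $ a)" by (intro continuous_intros)
  ultimately obtain M where M: "M \<in> S" and min: "\<And>N. N \<in> S \<Longrightarrow> M $ a $ a \<le> N $ a $ a"
    using continuous_attains_inf[of S "\<lambda>M. M $ a $ a"] by blast
  have "0 \<le> M $ a $ a"
    using psd_kernel_diag_nonneg[of "\<lambda>i j. M $ i $ j" a] M unfolding S_iff by blast
  then have "\<exists>p. vector_coloring G (M $ a $ a + 1) p"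
    using M unfolding vector_coloring_iff_psd_kernel S_iff
    by (intro conjI exI[of _ "\<lambda>i j. M $ i $ j"]) simp_all
  moreover have "M $ a $ a + 1 \<le> s" if "vector_coloring G s q" for s q
  proof (cases "s - 1 \<le> n")
    case True
    have "(\<chi> i j. vec_inner (q i) (q j)) \<in> S"
      using that True unfolding S_iff vector_coloring_def
      by (auto intro!: psd_kernel_eqI[OF psd_kernel_gram])
    from min[OF this] show ?thesis
      using that unfolding vector_coloring_def by simp
  next
    case False
    then show ?thesis using M unfolding S_iff by linarith
  qed
  ultimately show ?thesis by blast
qed

lemma optimal_vector_coloring_exists:
  assumes "irreflp G"
  shows "\<exists>p. optimal_vector_coloring G p"
    and "vector_coloring G s q \<Longrightarrow> vector_chromatic_number G \<le> s"
proof -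
  obtain t p where t: "vector_coloring G t p" "\<And>s q. vector_coloring G s q \<Longrightarrow> t \<le> s"
    using minimal_vector_coloring_exists[OF assms] by blast
  have "vector_chromatic_number G = t"
    unfolding vector_chromatic_number_def by (rule Least_equality) (use t in blast)+
  with t show "\<exists>p. optimal_vector_coloring G p"
    and "vector_coloring G s q \<Longrightarrow> vector_chromatic_number G \<le> s"
    unfolding optimal_vector_coloring_def by blast+
qed


section \<open>Strong duality\<close>

text \<open>No positive semidefinite matrix has all diagonal entries below \<open>\<chi>\<^sub>v - 1\<close> and all
  entries on edges at most \<open>-1\<close>. A hyperplane separating these two convex sets is, after
  symmetrisation and normalisation, a dual solution of value at least \<open>\<chi>\<^sub>v\<close>.\<close>

lemma strong_duality:
  fixes G :: "'a::finite \<Rightarrow> 'a \<Rightarrow> bool"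
  assumes "simple_graph G"
  shows "\<exists>B. dual_feasible G B \<and> vector_chromatic_number G \<le> sum_entries B"
proof -
  define t where "t = vector_chromatic_number G"
  have sym: "G i j = G j i" and irr: "\<not> G i i" for i j
    using assms unfolding simple_graph_def by (auto simp: irreflp_def dest: sympD)
  have irrefl: "irreflp G" using irr by (simp add: irreflp_def)
  define P where "P = {M :: real^'a^'a. psd_kernel (\<lambda>i j. M $ i $ j)}"
  \<comment> \<open>The strict diagonal bound makes \<open>W\<close> miss \<open>P\<close>. Entries
    at distinct non-adjacent indices are unconstrained, which will force the normal \<open>A\<close>
    to vanish there.\<close>
  define W where "W = {M :: real^'a^'a. (\<forall>i. M $ i $ i < t - 1) \<and> (\<forall>i j. G i j \<longrightarrow> M $ i $ j \<le> -1)}"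
  have P_cone: "c *\<^sub>R M \<in> P" if "M \<in> P" "0 \<le> c" for c M
    using that unfolding P_def by (auto intro: psd_kernel_eqI[OF psd_kernel_scale])
  have "M + N \<in> P" if "M \<in> P" "N \<in> P" for M N
    using that unfolding P_def by (auto intro: psd_kernel_eqI[OF psd_kernel_add])
  with P_cone have "convex P" by (simp add: convex_def)
  moreover have "convex W"
  proof (rule convexI)
    fix M N :: "real^'a^'a" and u v :: real
    assume MN: "M \<in> W" "N \<in> W" and uv: "0 \<le> u" "0 \<le> v" "u + v = 1"
    have "u * M $ i $ i + v * N $ i $ i < t - 1" for i
      by (rule convex_bound_lt) (use MN uv in \<open>auto simp: W_def\<close>)
    moreover have "u * M $ i $ j + v * N $ i $ j \<le> -1" if "G i j" for i j
      by (rule convex_bound_le) (use MN uv that in \<open>auto simp: W_def\<close>)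
    ultimately show "u *\<^sub>R M + v *\<^sub>R N \<in> W" by (simp add: W_def)
  qed
  moreover have W_mem: "(\<chi> i j. if i = j then t - 1 - e else if G i j then -1 else 0) \<in> W" if "0 < e" for e
    using that irr by (auto simp: W_def)
  then have "W \<noteq> {}" using zero_less_one by blast
  moreover have zero_P: "0 \<in> P" by (simp add: P_def psd_kernel_def quad_form_def)
  then have "P \<noteq> {}" by blast
  moreover have "W \<inter> P = {}"
  proof (rule ccontr)
    assume "W \<inter> P \<noteq> {}"
    then obtain M where MW: "M \<in> W" and MP: "M \<in> P" by blast
    define m where "m = Max (range (\<lambda>i. M $ i $ i))"
    have m: "M $ i $ i \<le> m" for i unfolding m_def by (rule Max_ge) auto
    have "m \<in> range (\<lambda>i. M $ i $ i)" unfolding m_def by (rule Max_in) auto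
    then have mt: "m < t - 1" using MW unfolding W_def by auto
    have m0: "0 \<le> m"
      using psd_kernel_diag_nonneg[of "\<lambda>i j. M $ i $ j"] MP m unfolding P_def
      by (meson mem_Collect_eq order_trans)
    \<comment> \<open>Raising every diagonal entry to the maximum \<open>m\<close> keeps the matrix
      in the cone and gives a coloring of value \<open>m + 1\<close>, below the chromatic
      number.\<close>
    have "psd_kernel (\<lambda>i j. if i = j then m - M $ i $ i else 0)"
    proof (rule psd_kernelI)
      fix f
      have "(\<Sum>j\<in>UNIV. f i * (if i = j then m - M $ i $ i else 0) * f j) = (m - M $ i $ i) * (f i)\<^sup>2" for i
        by (simp add: if_distrib if_distribR power2_eq_square cong: if_cong)
      then show "0 \<le> quad_form (\<lambda>i j. if i = j then m - M $ i $ i else 0) f"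
        unfolding quad_form_def using m by (simp add: sum_nonneg)
    qed auto
    then have "psd_kernel (\<lambda>i j. M $ i $ j + (if i = j then m - M $ i $ i else 0))"
      using MP psd_kernel_add unfolding P_def by blast
    then have "\<exists>p. vector_coloring G (m + 1) p"
      unfolding vector_coloring_iff_psd_kernel using m0 MW irr
      by (intro conjI exI[of _ "\<lambda>i j. M $ i $ j + (if i = j then m - M $ i $ i else 0)"])
        (auto simp: W_def)
    then have "t \<le> m + 1"
      using optimal_vector_coloring_exists(2)[OF irrefl] unfolding t_def by blast
    with mt show False by simp
  qed
  ultimately obtain A b where "A \<noteq> 0" and Wb: "\<And>M. M \<in> W \<Longrightarrow> A \<bullet> M \<le> b"
    and Pb: "\<And>M. M \<in> P \<Longrightarrow> b \<le> A \<bullet> M"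
    using separating_hyperplane_sets[of W P] by blast
  have "b \<le> 0" using Pb[OF zero_P] by simp
  with Wb have AW: "A \<bullet> M \<le> 0" if "M \<in> W" for M using that by fastforce
  have AP: "0 \<le> A \<bullet> M" if "M \<in> P" for M
  proof (rule ccontr)
    assume neg: "\<not> 0 \<le> A \<bullet> M"
    \<comment> \<open>The multiple is chosen so that its inner product with \<open>A\<close> is
      \<open>b - 1\<close>, below the bound on the cone.\<close>
    with \<open>b \<le> 0\<close> have "((b - 1) / (A \<bullet> M)) *\<^sub>R M \<in> P"
      by (intro P_cone that) (simp add: divide_nonpos_neg)
    from Pb[OF this] neg show False by simp
  qed
  have inner: "A \<bullet> M = (\<Sum>i\<in>UNIV. \<Sum>j\<in>UNIV. A $ i $ j * M $ i $ j)" for M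
    by (simp add: inner_vec_def)
  define E :: "'a \<Rightarrow> 'a \<Rightarrow> real^'a^'a" where "E i j = (\<chi> k l. if k = i \<and> l = j then 1 else 0)" for i j
  have AE: "A \<bullet> E i j = A $ i $ j" for i j
  proof -
    have "(\<Sum>l\<in>UNIV. A $ k $ l * E i j $ k $ l) = (if k = i then A $ i $ j else 0)" for k
      by (cases "k = i") (simp_all add: E_def if_distrib cong: if_cong)
    then show ?thesis by (simp add: inner)
  qed
  define W1 :: "real^'a^'a" where "W1 = (\<chi> i j. if i = j then t - 1 - 1 else if G i j then -1 else 0)"
  have W1: "W1 \<in> W" unfolding W1_def by (rule W_mem) simp
  have shift: "W1 + c *\<^sub>R E i j \<in> W" if c: "c \<le> 0 \<or> i \<noteq> j \<and> \<not> G i j" for c i j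
  proof -
    have le: "c * E i j $ k $ l \<le> 0" if "k = l \<or> G k l" for k l
      using that c by (auto simp: E_def)
    have "W1 $ k $ k + c * E i j $ k $ k < t - 1" for k
    proof -
      have "W1 $ k $ k < t - 1" using W1 by (simp add: W_def)
      with le[of k k] show ?thesis by simp
    qed
    moreover have "W1 $ k $ l + c * E i j $ k $ l \<le> -1" if "G k l" for k l
    proof -
      have "W1 $ k $ l \<le> -1" using W1 that by (simp add: W_def)
      with le[of k l] that show ?thesis by simp
    qed
    ultimately show ?thesis by (simp add: W_def)
  qed
  \<comment> \<open>The step length makes the inner product with \<open>A\<close> equal to 1, which
    \<open>AW\<close> forbids on \<open>W\<close>.\<close>
  have entry: "W1 + ((1 - A \<bullet> W1) / A $ i $ j) *\<^sub>R E i j \<notin> W" if "A $ i $ j \<noteq> 0" for i j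
    using AW[of "W1 + ((1 - A \<bullet> W1) / A $ i $ j) *\<^sub>R E i j"] that
    by (auto simp: inner_add_right AE)
  have nonneg: "0 \<le> A $ i $ j" for i j
  proof (rule ccontr)
    assume neg: "\<not> 0 \<le> A $ i $ j"
    then have "(1 - A \<bullet> W1) / A $ i $ j \<le> 0"
      using AW[OF W1] by (simp add: divide_nonneg_neg)
    then have "W1 + ((1 - A \<bullet> W1) / A $ i $ j) *\<^sub>R E i j \<in> W"
      by (rule shift[OF disjI1])
    with entry neg show False by force
  qed
  have zero: "A $ i $ j = 0" if "i \<noteq> j" "\<not> G i j" for i j
  proof (rule ccontr)
    assume "A $ i $ j \<noteq> 0"
    moreover have "W1 + ((1 - A \<bullet> W1) / A $ i $ j) *\<^sub>R E i j \<in> W"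
      using that by (intro shift) simp
    ultimately show False using entry by blast
  qed
  have quad: "0 \<le> quad_form (\<lambda>i j. A $ i $ j) f" for f
  proof -
    have "(\<chi> i j. f i * f j) \<in> P" unfolding P_def by (auto intro: psd_kernel_eqI[OF psd_kernel_rank_one])
    from AP[OF this] show ?thesis by (simp add: inner quad_form_def mult_ac)
  qed
  \<comment> \<open>The hyperplane was found among all matrices, so \<open>A\<close> need not be
    symmetric; its symmetric part has the same quadratic form.\<close>
  define B0 where "B0 i j = (A $ i $ j + A $ j $ i) / 2" for i j
  have "quad_form B0 f = quad_form (\<lambda>i j. A $ i $ j) f" for f
  proof -
    have "quad_form (\<lambda>i j. A $ j $ i) f = quad_form (\<lambda>i j. A $ i $ j) f"
      unfolding quad_form_def by (subst sum.swap) (simp add: mult_ac)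
    moreover have "quad_form B0 f = (quad_form (\<lambda>i j. A $ i $ j) f + quad_form (\<lambda>i j. A $ j $ i) f) / 2"
      unfolding quad_form_def B0_def sum_divide_distrib sum.distrib[symmetric]
      by (simp add: algebra_simps)
    ultimately show ?thesis by simp
  qed
  then have psd: "psd_kernel B0"
    by (intro psd_kernelI) (auto simp: B0_def quad add.commute)
  define r where "r = (\<Sum>i\<in>UNIV. A $ i $ i)"
  \<comment> \<open>A positive semidefinite matrix with zero trace vanishes; entrywise nonnegativity
    then carries this from \<open>B0\<close> to \<open>A\<close>.\<close>
  have "r \<noteq> 0"
  proof
    assume "r = 0"
    then have "A $ i $ i = 0" for i
      unfolding r_def using nonneg by (simp add: sum_nonneg_eq_0_iff)
    then have "B0 i j = 0" for i j
      using psd_kernel_zero_diag[OF psd, of i j] by (simp add: B0_def)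
    then have "A $ i $ j = 0" for i j
      using nonneg[of i j] nonneg[of j i] unfolding B0_def by (metis add_nonneg_eq_0_iff divide_eq_0_iff zero_neq_numeral)
    then have "A = 0" by (simp add: vec_eq_iff)
    with \<open>A \<noteq> 0\<close> show False ..
  qed
  moreover have "0 \<le> r" unfolding r_def by (simp add: sum_nonneg nonneg)
  ultimately have r: "0 < r" by simp
  define s where "s = (\<Sum>i\<in>UNIV. \<Sum>j\<in>UNIV. A $ i $ j)"
  have "(t - e) * r \<le> s" if "0 < e" for e
  proof -
    have "(\<Sum>j\<in>UNIV. A $ i $ j * (if i = j then t - 1 - e else if G i j then -1 else 0)) =
        (t - e) * A $ i $ i - (\<Sum>j\<in>UNIV. A $ i $ j)" for i
    proof -
      have "(\<Sum>j\<in>UNIV. A $ i $ j * (if i = j then t - 1 - e else if G i j then -1 else 0)) =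
        (\<Sum>j\<in>UNIV. (if i = j then (t - e) * A $ i $ j else 0) - A $ i $ j)"
        using zero by (intro sum.cong) (auto simp: algebra_simps)
      then show ?thesis by (simp add: sum_subtractf)
    qed
    then show ?thesis
      using AW[OF W_mem[OF that]] by (simp add: inner sum_subtractf r_def s_def sum_distrib_left)
  qed
  \<comment> \<open>If \<open>t * r\<close> exceeded \<open>s\<close>, taking \<open>e\<close> to be
    half the gap divided by \<open>r\<close> would contradict the inequality.\<close>
  from this[of "(t * r - s) / (2 * r)"] r have ts: "t * r \<le> s"
    by (cases "t * r \<le> s") (auto simp: field_simps)
  define B :: "real^'a^'a" where "B = (\<chi> i j. B0 i j / r)"
  have "sum_entries B = s / r"
  proof -
    have "(\<Sum>i\<in>UNIV. \<Sum>j\<in>UNIV. B0 i j) = (s + (\<Sum>i\<in>UNIV. \<Sum>j\<in>UNIV. A $ j $ i)) / 2"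
      unfolding s_def B0_def by (simp add: sum_divide_distrib sum.distrib add_divide_distrib)
    also have "(\<Sum>i\<in>UNIV. \<Sum>j\<in>UNIV. A $ j $ i) = s"
      unfolding s_def by (rule sum.swap)
    finally show ?thesis by (simp add: sum_entries_def B_def sum_divide_distrib[symmetric])
  qed
  moreover have "dual_feasible G B"
    unfolding dual_feasible_def
  proof (intro conjI allI impI)
    show "B $ i $ j = 0" if "i \<noteq> j \<and> \<not> G i j" for i j
      using that zero[of i j] zero[of j i] sym[of i j] by (auto simp: B_def B0_def)
    show "0 \<le> B $ i $ j" for i j using nonneg r by (simp add: B_def B0_def)
    show "trace B = 1"
      using r by (simp add: trace_def B_def B0_def sum_divide_distrib[symmetric] r_def[symmetric])
    show "psd_matrix B"
      using r unfolding psd_matrix_iff_psd_kernel B_def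
      by (intro psd_kernel_eqI[OF psd_kernel_scale[OF psd, of "1 / r"]]) simp_all
  qed
  ultimately show ?thesis
    using ts r by (auto simp: t_def[symmetric] field_simps)
qed


section \<open>Complementary slackness for optimal dual solutions\<close>

lemma vector_chromatic_number_ge_2:
  assumes "simple_graph G" and "nonempty_graph G"
  shows "2 \<le> vector_chromatic_number G"
proof -
  obtain p where p: "optimal_vector_coloring G p"
    using optimal_vector_coloring_exists(1) assms(1) unfolding simple_graph_def by blast
  obtain i j where "G i j" using assms(2) unfolding nonempty_graph_def by blast
  with p have "vec_inner (p i) (p j) \<le> -1" "vec_inner (p i) (p i) = vector_chromatic_number G - 1"
    "vec_inner (p j) (p j) = vector_chromatic_number G - 1"
    unfolding optimal_vector_coloring_def vector_coloring_def by auto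
  then show ?thesis
    using psd_kernel_abs_le[OF psd_kernel_gram[of p], of i j] by linarith
qed

lemma dual_feasible_psd_kernel: "dual_feasible G B \<Longrightarrow> psd_kernel (\<lambda>i j. B $ i $ j)"
  by (simp add: dual_feasible_def psd_matrix_iff_psd_kernel)

text \<open>Complementary slackness: for an optimal coloring \<open>q\<close> the products \<open>B\<^sub>i\<^sub>j q\<^sub>i\<^sup>T q\<^sub>j\<close> are forced
  and sum to zero over each row.\<close>

lemma dual_optimal_row_sum:
  fixes G :: "'a::finite \<Rightarrow> 'a \<Rightarrow> bool"
  assumes G: "simple_graph G" and B: "dual_optimal G B"
  shows "(\<Sum>j\<in>UNIV. B $ i $ j) = vector_chromatic_number G * B $ i $ i"
proof -
  define t where "t = vector_chromatic_number G"
  obtain q where q: "optimal_vector_coloring G q"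
    using optimal_vector_coloring_exists(1) G unfolding simple_graph_def by blast
  have feas: "dual_feasible G B" using B by (simp add: dual_optimal_def)
  have psd: "psd_kernel (\<lambda>i j. B $ i $ j)" by (rule dual_feasible_psd_kernel[OF feas])
  have tr: "(\<Sum>i\<in>UNIV. B $ i $ i) = 1" using feas by (simp add: dual_feasible_def trace_def)
  have "t \<le> sum_entries B"
    using strong_duality[OF G] B unfolding dual_optimal_def t_def by force
  \<comment> \<open>The primal slack: zero on the diagonal and nonnegative on edges. Pairing it with
    \<open>B\<close> leaves \<open>t\<close> minus the dual value minus the pairing of
    \<open>B\<close> with the Gram matrix.\<close>
  define S where "S i j = (if i = j then t else 0) - 1 - vec_inner (q i) (q j)" for i j
  have term_nonneg: "0 \<le> B $ i $ j * S i j" for i j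
    using feas q unfolding S_def dual_feasible_def optimal_vector_coloring_def vector_coloring_def t_def
    by (cases "i = j"; cases "G i j") auto
  have row_S: "(\<Sum>j\<in>UNIV. B $ i $ j * S i j) = t * B $ i $ i - (\<Sum>j\<in>UNIV. B $ i $ j)
      - (\<Sum>j\<in>UNIV. B $ i $ j * vec_inner (q i) (q j))" for i
  proof -
    have "(\<Sum>j\<in>UNIV. B $ i $ j * S i j) = (\<Sum>j\<in>UNIV. (if i = j then t * B $ i $ j else 0)
        - B $ i $ j - B $ i $ j * vec_inner (q i) (q j))"
      by (intro sum.cong) (auto simp: S_def algebra_simps)
    then show ?thesis by (simp add: sum_subtractf)
  qed
  then have "(\<Sum>i\<in>UNIV. \<Sum>j\<in>UNIV. B $ i $ j * S i j) = t - sum_entries B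
      - (\<Sum>i\<in>UNIV. \<Sum>j\<in>UNIV. B $ i $ j * vec_inner (q i) (q j))"
    by (simp add: sum_subtractf sum_distrib_left[symmetric] tr sum_entries_def)
  moreover have "0 \<le> (\<Sum>i\<in>UNIV. \<Sum>j\<in>UNIV. B $ i $ j * vec_inner (q i) (q j))"
    by (rule trace_gram_nonneg[OF psd])
  moreover have S_sum: "0 \<le> (\<Sum>i\<in>UNIV. \<Sum>j\<in>UNIV. B $ i $ j * S i j)"
    by (intro sum_nonneg term_nonneg)
  ultimately have R0: "(\<Sum>i\<in>UNIV. \<Sum>j\<in>UNIV. B $ i $ j * vec_inner (q i) (q j)) = 0"
    and S0: "(\<Sum>i\<in>UNIV. \<Sum>j\<in>UNIV. B $ i $ j * S i j) = 0"
    using \<open>t \<le> sum_entries B\<close> by linarith+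
  have S0': "(\<Sum>j\<in>UNIV. B $ i $ j * S i j) = 0"
    using S0 by (subst (asm) sum_nonneg_eq_0_iff) (simp_all add: sum_nonneg term_nonneg)
  have "vec_inner (q i) (\<Sum>j\<in>UNIV. B $ i $ j *\<^sub>R q j) = 0"
    using trace_gram_eq_0_imp_null[OF psd R0] by simp
  then have "(\<Sum>j\<in>UNIV. B $ i $ j * vec_inner (q i) (q j)) = 0"
    by (simp add: vec_inner_sum_right vec_inner_scaleR_right)
  with S0' row_S show ?thesis by (simp add: t_def)
qed


lemma dual_optimal_off_diagonal_row_sum:
  fixes G :: "'a::finite \<Rightarrow> 'a \<Rightarrow> bool"
  assumes "simple_graph G" and "dual_optimal G B"
  shows "(\<Sum>j\<in>UNIV. if i = j then 0 else B $ i $ j) = (vector_chromatic_number G - 1) * B $ i $ i"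
proof -
  have "(\<Sum>j\<in>UNIV. if i = j then 0 else B $ i $ j) =
      (\<Sum>j\<in>UNIV. B $ i $ j - (if i = j then B $ i $ j else 0))"
    by (intro sum.cong) auto
  then show ?thesis
    by (simp add: sum_subtractf dual_optimal_row_sum[OF assms] algebra_simps)
qed


section \<open>Weighted Laplacians\<close>

lemma laplacian_quad_form:
  fixes A :: "'a::finite \<Rightarrow> 'a \<Rightarrow> real"
  assumes sym: "\<And>i j. A i j = A j i" and row: "\<And>i. (\<Sum>j\<in>UNIV. A i j) = d i"
  shows "quad_form (\<lambda>i j. (if i = j then d i else 0) - A i j) f =
    (\<Sum>i\<in>UNIV. \<Sum>j\<in>UNIV. A i j * (f i - f j)\<^sup>2) / 2"
proof -
  have "(\<Sum>j\<in>UNIV. f i * ((if i = j then d i else 0) - A i j) * f j) =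
      d i * (f i)\<^sup>2 - (\<Sum>j\<in>UNIV. A i j * f i * f j)" for i
  proof -
    have "(\<Sum>j\<in>UNIV. f i * ((if i = j then d i else 0) - A i j) * f j) =
        (\<Sum>j\<in>UNIV. (if i = j then d i * (f i)\<^sup>2 else 0) - A i j * f i * f j)"
      by (intro sum.cong) (auto simp: power2_eq_square algebra_simps)
    then show ?thesis by (simp add: sum_subtractf)
  qed
  then have l: "quad_form (\<lambda>i j. (if i = j then d i else 0) - A i j) f =
      (\<Sum>i\<in>UNIV. d i * (f i)\<^sup>2) - (\<Sum>i\<in>UNIV. \<Sum>j\<in>UNIV. A i j * f i * f j)"
    unfolding quad_form_def by (simp add: sum_subtractf)
  have s1: "(\<Sum>i\<in>UNIV. \<Sum>j\<in>UNIV. A i j * (f i)\<^sup>2) = (\<Sum>i\<in>UNIV. d i * (f i)\<^sup>2)"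
    by (simp add: sum_distrib_right[symmetric] row)
  have "(\<Sum>i\<in>UNIV. \<Sum>j\<in>UNIV. A i j * (f j)\<^sup>2) = (\<Sum>i\<in>UNIV. \<Sum>j\<in>UNIV. A j i * (f i)\<^sup>2)"
    by (rule sum.swap)
  also have "\<dots> = (\<Sum>i\<in>UNIV. \<Sum>j\<in>UNIV. A i j * (f i)\<^sup>2)"
    by (intro sum.cong refl arg_cong2[where f = "(*)"] sym)
  finally have s2: "(\<Sum>i\<in>UNIV. \<Sum>j\<in>UNIV. A i j * (f j)\<^sup>2) = (\<Sum>i\<in>UNIV. d i * (f i)\<^sup>2)"
    using s1 by simp
  have "(\<Sum>i\<in>UNIV. \<Sum>j\<in>UNIV. A i j * (f i - f j)\<^sup>2) =
      (\<Sum>i\<in>UNIV. \<Sum>j\<in>UNIV. A i j * (f i)\<^sup>2) + (\<Sum>i\<in>UNIV. \<Sum>j\<in>UNIV. A i j * (f j)\<^sup>2)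
      - 2 * (\<Sum>i\<in>UNIV. \<Sum>j\<in>UNIV. A i j * f i * f j)"
    by (simp add: power2_diff algebra_simps sum.distrib sum_subtractf sum_distrib_left)
  then show ?thesis unfolding l s1 s2 by simp
qed

lemma psd_kernel_laplacian:
  assumes sym: "\<And>i j. A i j = A j i" and "\<And>i j. 0 \<le> A i j"
    and row: "\<And>i. (\<Sum>j\<in>UNIV. A i j) = d i"
  shows "psd_kernel (\<lambda>i j. (if i = j then d i else 0) - A i j)"
proof (rule psd_kernelI)
  show "0 \<le> quad_form (\<lambda>i j. (if i = j then d i else 0) - A i j) f" for f
    unfolding laplacian_quad_form[of A, OF sym row] using assms(2) by (simp add: sum_nonneg)
qed (use sym in auto)

text \<open>In each coordinate the Dirichlet energy vanishes, so values agree along edges of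
  positive weight and hence everywhere by connectedness.\<close>

lemma laplacian_null_imp_constant:
  fixes p :: "'a::finite \<Rightarrow> rvec"
  assumes sym: "\<And>i j. A i j = A j i" and nonneg: "\<And>i j. 0 \<le> A i j"
    and row: "\<And>i. (\<Sum>j\<in>UNIV. A i j) = d i"
    and conn: "connected_graph (\<lambda>i j. A i j \<noteq> 0)"
    and null: "\<And>i. (\<Sum>j\<in>UNIV. ((if i = j then d i else 0) - A i j) *\<^sub>R p j) = 0"
  shows "p i = p j"
proof (rule poly_mapping_eqI)
  fix k
  define f where "f i = Poly_Mapping.lookup (p i) k" for i
  have "(\<Sum>j\<in>UNIV. ((if i = j then d i else 0) - A i j) * f j) = 0" for i
    using arg_cong[OF null[of i], of "\<lambda>x. Poly_Mapping.lookup x k"]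
    by (simp add: f_def lookup_sum lookup_scaleR)
  then have "quad_form (\<lambda>i j. (if i = j then d i else 0) - A i j) f = 0"
    unfolding quad_form_def by (simp add: mult.assoc sum_distrib_left[symmetric])
  then have "(\<Sum>i\<in>UNIV. \<Sum>j\<in>UNIV. A i j * (f i - f j)\<^sup>2) = 0"
    unfolding laplacian_quad_form[of A, OF sym row] by simp
  then have "\<forall>i j. A i j * (f i - f j)\<^sup>2 = 0"
    using nonneg by (simp add: sum_nonneg_eq_0_iff sum_nonneg)
  then have step: "f i = f j" if "A i j \<noteq> 0" for i j
    using that by auto
  have "(\<lambda>i j. A i j \<noteq> 0)\<^sup>*\<^sup>* i j" using conn unfolding connected_graph_def by blast
  then have "f i = f j" by (induction rule: rtranclp_induct) (auto dest: step)
  then show "Poly_Mapping.lookup (p i) k = Poly_Mapping.lookup (p j) k" by (simp add: f_def)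
qed


section \<open>Colorings of the product\<close>

lemma sum_UNIV_prod:
  "(\<Sum>x\<in>(UNIV::('a::finite \<times> 'b::finite) set). f x) = (\<Sum>i\<in>UNIV. \<Sum>l\<in>UNIV. f (i, l))"
  by (simp add: sum.cartesian_product UNIV_Times_UNIV[symmetric] del: UNIV_Times_UNIV)

lemma sum_kronecker:
  fixes f :: "'a::finite \<Rightarrow> 'a \<Rightarrow> real" and g :: "'b::finite \<Rightarrow> 'b \<Rightarrow> real"
  shows "(\<Sum>x\<in>UNIV. \<Sum>y\<in>UNIV. f (fst x) (fst y) * g (snd x) (snd y)) =
    (\<Sum>i\<in>UNIV. \<Sum>j\<in>UNIV. f i j) * (\<Sum>l\<in>UNIV. \<Sum>k\<in>UNIV. g l k)"
  by (simp add: sum_UNIV_prod sum_product)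

text \<open>Summing the null condition over \<open>l\<close> replaces \<open>C\<close> by its column
  sums, which are \<open>t\<close> times its diagonal; this is why the diagonal supplies the
  averaging weights.\<close>

lemma marginal_null:
  fixes p :: "'a::finite \<Rightarrow> 'b::finite \<Rightarrow> rvec"
  assumes null: "\<And>i l. (\<Sum>j\<in>UNIV. \<Sum>k\<in>UNIV. (B i j * C l k) *\<^sub>R p j k) = 0"
    and col: "\<And>k. (\<Sum>l\<in>UNIV. C l k) = t * C k k" and t: "t \<noteq> 0"
  shows "(\<Sum>j\<in>UNIV. B i j *\<^sub>R (\<Sum>k\<in>UNIV. C k k *\<^sub>R p j k)) = 0"
proof -
  have "0 = (\<Sum>l\<in>UNIV. \<Sum>j\<in>UNIV. \<Sum>k\<in>UNIV. (B i j * C l k) *\<^sub>R p j k)"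
    by (simp add: null)
  also have "\<dots> = (\<Sum>j\<in>UNIV. \<Sum>k\<in>UNIV. \<Sum>l\<in>UNIV. (B i j * C l k) *\<^sub>R p j k)"
    by (subst sum.swap, rule sum.cong[OF refl], rule sum.swap)
  also have "\<dots> = (\<Sum>j\<in>UNIV. \<Sum>k\<in>UNIV. (B i j * (t * C k k)) *\<^sub>R p j k)"
    by (simp add: scaleR_left.sum[symmetric] sum_distrib_left[symmetric] col)
  also have "\<dots> = t *\<^sub>R (\<Sum>j\<in>UNIV. B i j *\<^sub>R (\<Sum>k\<in>UNIV. C k k *\<^sub>R p j k))"
    by (simp add: scaleR_sum_right mult_ac)
  finally show ?thesis using t by simp
qed

text \<open>Recovers a coloring of a factor from one summand of a product coloring. At
  \<open>c = 0\<close> the summand vanishes and any optimal coloring will do, since the convex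
  combination still has to name one.\<close>

lemma scaled_optimal_coloring:
  assumes "irreflp G" and c: "0 \<le> c"
    and diag: "\<And>i. vec_inner (a i) (a i) = c * (vector_chromatic_number G - 1)"
    and edge: "\<And>i j. G i j \<Longrightarrow> vec_inner (a i) (a j) \<le> - c"
  shows "\<exists>q. optimal_vector_coloring G q \<and> (\<forall>i j. vec_inner (a i) (a j) = c * vec_inner (q i) (q j))"
proof (cases "c = 0")
  case True
  then have "a i = 0" for i using diag[of i] by (simp add: vec_inner_self_eq_0_iff)
  then show ?thesis using optimal_vector_coloring_exists(1)[OF assms(1)] True by auto
next
  case False
  define q where "q i = (1 / sqrt c) *\<^sub>R a i" for i
  have q: "vec_inner (q i) (q j) = vec_inner (a i) (a j) / c" for i j
    using c by (simp add: q_def vec_inner_scaleR_left vec_inner_scaleR_right)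
  have "1 \<le> vector_chromatic_number G"
    using optimal_vector_coloring_exists(1)[OF assms(1)]
    unfolding optimal_vector_coloring_def vector_coloring_def by blast
  then have "optimal_vector_coloring G q"
    using c False edge unfolding optimal_vector_coloring_def vector_coloring_def
    by (auto simp: q diag divide_le_eq)
  then show ?thesis using False by (auto simp: q)
qed

text \<open>Pairing the \<open>i\<close>-th null relation with \<open>a i\<close> gives
  \<open>(\<alpha> + c) * B i i\<close> as \<open>c\<close> times a row sum; summing over
  \<open>i\<close> brings in the trace and the total.\<close>

lemma null_vectors_norm:
  fixes a :: "'a::finite \<Rightarrow> rvec"
  assumes tr: "(\<Sum>i\<in>UNIV. B i i) = 1" and tot: "(\<Sum>i\<in>UNIV. \<Sum>j\<in>UNIV. B i j) = t"
    and null: "\<And>i. (\<Sum>j\<in>UNIV. B i j *\<^sub>R a j) = 0"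
    and diag: "\<And>i. vec_inner (a i) (a i) = \<alpha>"
    and off: "\<And>i j. i \<noteq> j \<Longrightarrow> B i j \<noteq> 0 \<Longrightarrow> vec_inner (a i) (a j) = - c"
  shows "\<alpha> = c * (t - 1)"
proof -
  have "(\<alpha> + c) * B i i = c * (\<Sum>j\<in>UNIV. B i j)" for i
  proof -
    have "vec_inner (a i) (\<Sum>j\<in>UNIV. B i j *\<^sub>R a j) = 0"
      by (simp add: null)
    then have "0 = (\<Sum>j\<in>UNIV. B i j * vec_inner (a i) (a j))"
      by (simp add: vec_inner_sum_right vec_inner_scaleR_right)
    also have "\<dots> = (\<Sum>j\<in>UNIV. (if i = j then (\<alpha> + c) * B i i else 0) - c * B i j)"
    proof (rule sum.cong[OF refl])
      show "B i j * vec_inner (a i) (a j) = (if i = j then (\<alpha> + c) * B i i else 0) - c * B i j" for j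
        by (cases "i = j"; cases "B i j = 0") (auto simp: off diag algebra_simps)
    qed
    finally show ?thesis by (simp add: sum_subtractf sum_distrib_left)
  qed
  then have "(\<Sum>i\<in>UNIV. (\<alpha> + c) * B i i) = c * t"
    by (simp add: tot[symmetric] sum_distrib_left)
  then have "(\<alpha> + c) * 1 = c * t"
    unfolding sum_distrib_left[symmetric] tr .
  then show ?thesis by (simp add: algebra_simps)
qed


text \<open>Write \<open>B = D + A\<close> and \<open>C = D' + A'\<close> with \<open>D, D'\<close> diagonal and put \<open>\<tau> = t - 1\<close>. The matrix
  \<open>\<tau> D\<otimes>D' + A\<otimes>A'\<close> is a dual solution of the product up to scaling, and
  \<open>(\<tau> + 1) (\<tau> D\<otimes>D' + A\<otimes>A') = \<tau> B\<otimes>C + (\<tau> D - A)\<otimes>(\<tau> D' - A')\<close>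
  exhibits it as positive semidefinite. By the row sum identity \<open>\<tau> D - A\<close> is a weighted
  Laplacian.\<close>

lemma product_coloring_null:
  fixes G :: "'a::finite \<Rightarrow> 'a \<Rightarrow> bool" and H :: "'b::finite \<Rightarrow> 'b \<Rightarrow> bool"
  assumes G: "simple_graph G" "nonempty_graph G" and H: "simple_graph H"
    and t: "vector_chromatic_number G = t" "vector_chromatic_number H = t"
    and B: "dual_optimal G B" and C: "dual_optimal H C"
    and p: "optimal_vector_coloring (categorical_product G H) p"
  defines "L \<equiv> \<lambda>i j. (if i = j then (t - 1) * B $ i $ i else 0) - (if i = j then 0 else B $ i $ j)"
    and "L' \<equiv> \<lambda>l k. (if l = k then (t - 1) * C $ l $ l else 0) - (if l = k then 0 else C $ l $ k)"
  shows "vector_chromatic_number (categorical_product G H) = t"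
    and "(\<Sum>j\<in>UNIV. \<Sum>k\<in>UNIV. (B $ i $ j * C $ l $ k) *\<^sub>R p (j, k)) = 0"
    and "(\<Sum>j\<in>UNIV. \<Sum>k\<in>UNIV. (L i j * L' l k) *\<^sub>R p (j, k)) = 0"
    and "i \<noteq> j \<Longrightarrow> B $ i $ j \<noteq> 0 \<Longrightarrow> l \<noteq> k \<Longrightarrow> C $ l $ k \<noteq> 0 \<Longrightarrow>
      vec_inner (p (i, l)) (p (j, k)) = -1"
proof -
  define s where "s = vector_chromatic_number (categorical_product G H)"
  define \<tau> where "\<tau> = t - 1"
  have \<tau>: "1 \<le> \<tau>" using vector_chromatic_number_ge_2[OF G] by (simp add: \<tau>_def t)
  have feasB: "dual_feasible G B" and feasC: "dual_feasible H C"
    using B C by (simp_all add: dual_optimal_def)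
  have trB: "(\<Sum>i\<in>UNIV. B $ i $ i) = 1" and trC: "(\<Sum>l\<in>UNIV. C $ l $ l) = 1"
    using feasB feasC by (simp_all add: dual_feasible_def trace_def)
  note psdB = dual_feasible_psd_kernel[OF feasB] and psdC = dual_feasible_psd_kernel[OF feasC]
  define D where "D i j = (if i = j then B $ i $ i else 0)" for i j
  define D' where "D' l k = (if l = k then C $ l $ l else 0)" for l k
  define A where "A i j = (if i = j then 0 else B $ i $ j)" for i j
  define A' where "A' l k = (if l = k then 0 else C $ l $ k)" for l k
  have A_row: "(\<Sum>j\<in>UNIV. A i j) = \<tau> * B $ i $ i" for i
    unfolding A_def \<tau>_def t(1)[symmetric] by (rule dual_optimal_off_diagonal_row_sum[OF G(1) B])
  have A'_row: "(\<Sum>k\<in>UNIV. A' l k) = \<tau> * C $ l $ l" for l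
    unfolding A'_def \<tau>_def t(2)[symmetric] by (rule dual_optimal_off_diagonal_row_sum[OF H C])
  have A_nonneg: "0 \<le> A i j" and A'_nonneg: "0 \<le> A' l k" for i j l k
    using feasB feasC by (simp_all add: A_def A'_def dual_feasible_def)
  have symA: "A i j = A j i" and symA': "A' l k = A' k l" for i j l k
    using psd_kernel_sym[OF psdB, of i j] psd_kernel_sym[OF psdC, of l k] by (simp_all add: A_def A'_def)
  have L: "L = (\<lambda>i j. (if i = j then \<tau> * B $ i $ i else 0) - A i j)"
    and L': "L' = (\<lambda>l k. (if l = k then \<tau> * C $ l $ l else 0) - A' l k)"
    by (simp_all add: L_def L'_def A_def A'_def \<tau>_def fun_eq_iff)
  have AG: "A i j \<noteq> 0 \<Longrightarrow> G i j" and A'H: "A' l k \<noteq> 0 \<Longrightarrow> H l k" for i j l k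
    using feasB feasC by (auto simp: A_def A'_def dual_feasible_def split: if_splits)
  have psdL: "psd_kernel L"
    unfolding L by (rule psd_kernel_laplacian[OF symA A_nonneg A_row])
  have psdL': "psd_kernel L'"
    unfolding L' by (rule psd_kernel_laplacian[OF symA' A'_nonneg A'_row])
  define K1 where "K1 x y = B $ fst x $ fst y * C $ snd x $ snd y" for x y
  define K2 where "K2 x y = L (fst x) (fst y) * L' (snd x) (snd y)" for x y
  have psd1: "psd_kernel K1"
    unfolding K1_def
    by (rule psd_kernel_mult[OF psd_kernel_comp[where h = fst, OF psdB] psd_kernel_comp[where h = snd, OF psdC]])
  have psd2: "psd_kernel K2"
    unfolding K2_def
    by (rule psd_kernel_mult[OF psd_kernel_comp[where h = fst, OF psdL] psd_kernel_comp[where h = snd, OF psdL']])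
  define R where "R x y = vec_inner (p x) (p y)" for x y
  define DD where "DD x y = D (fst x) (fst y) * D' (snd x) (snd y)" for x y
  define AA where "AA x y = A (fst x) (fst y) * A' (snd x) (snd y)" for x y
  have split: "\<tau> * K1 x y + K2 x y = (\<tau> + 1) * (\<tau> * DD x y + AA x y)" for x y
  proof -
    obtain i l j k where xy: "x = (i, l)" "y = (j, k)" by (cases x, cases y)
    have eqs: "B $ i $ j = D i j + A i j" "C $ l $ k = D' l k + A' l k"
      "L i j = \<tau> * D i j - A i j" "L' l k = \<tau> * D' l k - A' l k"
      by (simp_all add: D_def D'_def A_def A'_def L_def L'_def \<tau>_def)
    have "\<tau> * ((d + a) * (d' + a')) + (\<tau> * d - a) * (\<tau> * d' - a') = (\<tau> + 1) * (\<tau> * (d * d') + a * a')"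
      for d a d' a' by (simp add: algebra_simps)
    then show ?thesis by (simp only: xy fst_conv snd_conv K1_def K2_def DD_def AA_def eqs)
  qed
  have p_diag: "R x x = s - 1" and p_edge: "categorical_product G H x y \<Longrightarrow> R x y \<le> -1" for x y
    using p unfolding optimal_vector_coloring_def vector_coloring_def R_def s_def
    by (auto simp del: split_paired_All)
  have DD_R: "DD x y * R x y = (s - 1) * DD x y" for x y
  proof (cases "x = y")
    case True
    then show ?thesis by (simp add: p_diag)
  next
    case False
    then have "fst x \<noteq> fst y \<or> snd x \<noteq> snd y" by (simp add: prod_eq_iff)
    then have "DD x y = 0" by (auto simp: DD_def D_def D'_def)
    then show ?thesis by simp
  qed
  have AA_R: "AA x y * (R x y + 1) \<le> 0" for x y
  proof (cases "AA x y = 0")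
    case False
    then have "A (fst x) (fst y) \<noteq> 0" "A' (snd x) (snd y) \<noteq> 0" by (auto simp: AA_def)
    then have "G (fst x) (fst y)" "H (snd x) (snd y)" by (simp_all add: AG A'H)
    then have "R x y \<le> -1" by (intro p_edge) (simp add: categorical_product_def case_prod_unfold)
    then show ?thesis by (intro mult_nonneg_nonpos) (simp_all add: AA_def A_nonneg A'_nonneg)
  qed simp
  have sum_DD: "(\<Sum>x\<in>UNIV. \<Sum>y\<in>UNIV. DD x y) = 1"
    unfolding DD_def sum_kronecker by (simp add: D_def D'_def trB trC)
  have sum_AA: "(\<Sum>x\<in>UNIV. \<Sum>y\<in>UNIV. AA x y) = \<tau> * \<tau>"
    unfolding AA_def sum_kronecker A_row A'_row by (simp add: sum_distrib_left[symmetric] trB trC)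
  \<comment> \<open>A coloring of \<open>G\<close> pulled back along the first projection colors the
    product.\<close>
  have "s \<le> t"
  proof -
    have irr: "irreflp G" "irreflp (categorical_product G H)"
      using G(1) by (auto simp: simple_graph_def irreflp_def categorical_product_def)
    obtain q where "optimal_vector_coloring G q"
      using optimal_vector_coloring_exists(1)[OF irr(1)] by blast
    then have "vector_coloring (categorical_product G H) t (\<lambda>x. q (fst x))"
      by (auto simp: optimal_vector_coloring_def vector_coloring_def categorical_product_def t)
    then show ?thesis
      unfolding s_def by (rule optimal_vector_coloring_exists(2)[OF irr(2)])
  qed
  define T1 where "T1 = (\<Sum>x\<in>UNIV. \<Sum>y\<in>UNIV. K1 x y * R x y)"
  define T2 where "T2 = (\<Sum>x\<in>UNIV. \<Sum>y\<in>UNIV. K2 x y * R x y)"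
  define T3 where "T3 = (\<Sum>x\<in>UNIV. \<Sum>y\<in>UNIV. AA x y * (R x y + 1))"
  have "0 \<le> T1" "0 \<le> T2"
    unfolding T1_def T2_def R_def by (rule trace_gram_nonneg[OF psd1] trace_gram_nonneg[OF psd2])+
  have "T3 \<le> 0" unfolding T3_def by (intro sum_nonpos AA_R)
  \<comment> \<open>The left side is nonnegative, while \<open>s - t\<close> and \<open>T3\<close>
    are nonpositive. All four quantities therefore vanish, giving the value of \<open>s\<close> and
    the slackness conditions together.\<close>
  have eq: "\<tau> * T1 + T2 = (\<tau> + 1) * (\<tau> * (s - t) + T3)"
  proof -
    have "\<tau> * (K1 x y * R x y) + K2 x y * R x y =
        (\<tau> + 1) * (\<tau> * ((s - 1) * DD x y) + AA x y * (R x y + 1) - AA x y)" for x y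
      unfolding DD_R[symmetric] using arg_cong[OF split[of x y], of "\<lambda>z. z * R x y"]
      by (simp add: algebra_simps)
    then have "\<tau> * T1 + T2 = (\<Sum>x\<in>UNIV. \<Sum>y\<in>UNIV.
        (\<tau> + 1) * (\<tau> * ((s - 1) * DD x y) + AA x y * (R x y + 1) - AA x y))"
      unfolding T1_def T2_def by (simp add: sum_distrib_left sum.distrib[symmetric])
    also have "\<dots> = (\<tau> + 1) * (\<tau> * ((s - 1) * 1) + T3 - \<tau> * \<tau>)"
      unfolding T3_def sum_DD[symmetric] sum_AA[symmetric]
      by (simp only: sum_distrib_left[symmetric] sum.distrib sum_subtractf)
    finally show ?thesis by (simp add: \<tau>_def algebra_simps)
  qed
  have "\<tau> * (s - t) \<le> 0" using \<tau> \<open>s \<le> t\<close> by (simp add: mult_nonneg_nonpos)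
  moreover have "0 \<le> \<tau> * T1" using \<tau> \<open>0 \<le> T1\<close> by simp
  moreover have "0 \<le> \<tau> * (s - t) + T3"
    using eq \<tau> \<open>0 \<le> \<tau> * T1\<close> \<open>0 \<le> T2\<close> by (smt (verit) mult_pos_neg)
  ultimately have zeros: "\<tau> * (s - t) = 0" "T3 = 0" using \<open>T3 \<le> 0\<close> by linarith+
  with eq have "\<tau> * T1 + T2 = 0" by simp
  with \<open>0 \<le> \<tau> * T1\<close> \<open>0 \<le> T2\<close> have "\<tau> * T1 = 0" "T2 = 0" by linarith+
  then have T: "T1 = 0" "T2 = 0" using \<tau> by simp_all
  have "s = t" using zeros(1) \<tau> by simp
  then show "vector_chromatic_number (categorical_product G H) = t" by (simp add: s_def)
  have "(\<Sum>y\<in>UNIV. K1 (i, l) y *\<^sub>R p y) = 0"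
    using T(1) unfolding T1_def R_def by (rule trace_gram_eq_0_imp_null[OF psd1])
  then show "(\<Sum>j\<in>UNIV. \<Sum>k\<in>UNIV. (B $ i $ j * C $ l $ k) *\<^sub>R p (j, k)) = 0"
    by (simp add: sum_UNIV_prod K1_def)
  have "(\<Sum>y\<in>UNIV. K2 (i, l) y *\<^sub>R p y) = 0"
    using T(2) unfolding T2_def R_def by (rule trace_gram_eq_0_imp_null[OF psd2])
  then show "(\<Sum>j\<in>UNIV. \<Sum>k\<in>UNIV. (L i j * L' l k) *\<^sub>R p (j, k)) = 0"
    by (simp add: sum_UNIV_prod K2_def)
  show "vec_inner (p (i, l)) (p (j, k)) = -1"
    if "i \<noteq> j" "B $ i $ j \<noteq> 0" "l \<noteq> k" "C $ l $ k \<noteq> 0"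
  proof -
    have neg: "0 \<le> - (AA x y * (R x y + 1))" for x y using AA_R[of x y] by simp
    have "(\<Sum>x\<in>UNIV. \<Sum>y\<in>UNIV. - (AA x y * (R x y + 1))) = 0"
      using zeros(2) by (simp add: T3_def sum_negf)
    then have "\<forall>x y. - (AA x y * (R x y + 1)) = 0"
      using neg by (simp add: sum_nonneg_eq_0_iff sum_nonneg)
    then have "AA (i, l) (j, k) * (R (i, l) (j, k) + 1) = 0" by simp
    then show ?thesis using that by (simp add: AA_def A_def A'_def R_def)
  qed
qed

text \<open>The tensor product is applied in two stages: \<open>L\<close> makes the
  \<open>L'\<close>-image of row \<open>i\<close> independent of \<open>i\<close>, so
  \<open>L'\<close> annihilates the difference of two rows, which is therefore constant.\<close>

lemma laplacian_product_null_imp_additive: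
  fixes p :: "'a::finite \<Rightarrow> 'b::finite \<Rightarrow> rvec" and L :: "'a \<Rightarrow> 'a \<Rightarrow> real" and L' :: "'b \<Rightarrow> 'b \<Rightarrow> real"
  assumes null: "\<And>i l. (\<Sum>j\<in>UNIV. \<Sum>k\<in>UNIV. (L i j * L' l k) *\<^sub>R p j k) = 0"
    and L: "\<And>p i j. (\<And>i. (\<Sum>j\<in>UNIV. L i j *\<^sub>R (p j :: rvec)) = 0) \<Longrightarrow> p i = p j"
    and L': "\<And>p l k. (\<And>l. (\<Sum>k\<in>UNIV. L' l k *\<^sub>R (p k :: rvec)) = 0) \<Longrightarrow> p l = p k"
  shows "p i l + p j k = p i k + p j l"
proof -
  have "(\<Sum>k\<in>UNIV. L' l k *\<^sub>R p i k) = (\<Sum>k\<in>UNIV. L' l k *\<^sub>R p j k)" for l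
  proof (rule L)
    show "(\<Sum>j\<in>UNIV. L i j *\<^sub>R (\<Sum>k\<in>UNIV. L' l k *\<^sub>R p j k)) = 0" for i
      using null[of i l] by (simp add: scaleR_sum_right)
  qed
  then have "p i l - p j l = p i k - p j k"
    by (intro L'[of "\<lambda>k. p i k - p j k"]) (simp add: scaleR_diff_right sum_subtractf)
  then show ?thesis by (simp add: algebra_simps)
qed

text \<open>Averages the four-term identity over \<open>k\<close> with weights \<open>v\<close> and
  then over \<open>j\<close> with weights \<open>u\<close>. The double mean on the left vanishes in
  the application.\<close>

lemma additive_marginals:
  fixes p :: "'a::finite \<Rightarrow> 'b::finite \<Rightarrow> rvec"
  assumes add: "\<And>i j l k. p i l + p j k = p i k + p j l"
    and u: "(\<Sum>i\<in>UNIV. u i) = 1" and v: "(\<Sum>l\<in>UNIV. v l) = 1"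
  shows "p i l + (\<Sum>j\<in>UNIV. u j *\<^sub>R (\<Sum>k\<in>UNIV. v k *\<^sub>R p j k)) =
    (\<Sum>k\<in>UNIV. v k *\<^sub>R p i k) + (\<Sum>j\<in>UNIV. u j *\<^sub>R p j l)"
proof -
  have v1: "(\<Sum>k\<in>UNIV. v k *\<^sub>R x) = x" and u1: "(\<Sum>j\<in>UNIV. u j *\<^sub>R x) = x" for x :: rvec
    by (simp_all add: scaleR_left.sum[symmetric] u v)
  have inner: "p i l + (\<Sum>k\<in>UNIV. v k *\<^sub>R p j k) = (\<Sum>k\<in>UNIV. v k *\<^sub>R p i k) + p j l" for j
  proof -
    have "(\<Sum>k\<in>UNIV. v k *\<^sub>R (p i l + p j k)) = (\<Sum>k\<in>UNIV. v k *\<^sub>R (p i k + p j l))"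
      by (simp only: add)
    then show ?thesis by (simp add: scaleR_add_right sum.distrib v1)
  qed
  have "(\<Sum>j\<in>UNIV. u j *\<^sub>R (p i l + (\<Sum>k\<in>UNIV. v k *\<^sub>R p j k))) =
      (\<Sum>j\<in>UNIV. u j *\<^sub>R ((\<Sum>k\<in>UNIV. v k *\<^sub>R p i k) + p j l))"
    by (simp only: inner)
  then show ?thesis by (simp add: scaleR_add_right sum.distrib u1)
qed

text \<open>The inner products \<open>a\<^sub>i\<^sup>T b\<^sub>l\<close> are \<open>f i + g l\<close> because all \<open>a\<^sub>i + b\<^sub>l\<close> have the same norm;
  the centering conditions then force them to vanish.\<close>

lemma centered_sum_orthogonal:
  fixes a :: "'a::finite \<Rightarrow> rvec" and b :: "'b::finite \<Rightarrow> rvec"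
  assumes u: "(\<Sum>i\<in>UNIV. u i) = 1" and v: "(\<Sum>l\<in>UNIV. v l) = 1"
    and ua: "(\<Sum>i\<in>UNIV. u i *\<^sub>R a i) = 0" and vb: "(\<Sum>l\<in>UNIV. v l *\<^sub>R b l) = 0"
    and norm: "\<And>i l. vec_inner (a i + b l) (a i + b l) = \<tau>"
  shows "\<exists>\<alpha> \<beta>. (\<forall>i. vec_inner (a i) (a i) = \<alpha>) \<and> (\<forall>l. vec_inner (b l) (b l) = \<beta>) \<and>
    (\<forall>i l. vec_inner (a i) (b l) = 0)"
proof -
  define \<alpha>\<^sub>0 where "\<alpha>\<^sub>0 = (\<Sum>i\<in>UNIV. u i * vec_inner (a i) (a i))"
  define \<beta>\<^sub>0 where "\<beta>\<^sub>0 = (\<Sum>l\<in>UNIV. v l * vec_inner (b l) (b l))"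
  have eq: "vec_inner (a i) (a i) + 2 * vec_inner (a i) (b l) + vec_inner (b l) (b l) = \<tau>" for i l
    using norm[of i l] by (simp add: vec_inner_add_left vec_inner_add_right vec_inner_commute)
  have ua': "(\<Sum>i\<in>UNIV. u i * vec_inner (a i) x) = 0" for x
    using arg_cong[OF ua, of "\<lambda>y. vec_inner y x"] by (simp add: vec_inner_sum_left vec_inner_scaleR_left)
  have vb': "(\<Sum>l\<in>UNIV. v l * vec_inner x (b l)) = 0" for x
    using arg_cong[OF vb, of "vec_inner x"] by (simp add: vec_inner_sum_right vec_inner_scaleR_right)
  have b: "vec_inner (b l) (b l) = \<tau> - \<alpha>\<^sub>0" for l
  proof -
    have "\<tau> = (\<Sum>i\<in>UNIV. u i) * \<tau>" by (simp add: u)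
    also have "\<dots> = (\<Sum>i\<in>UNIV. u i * vec_inner (a i) (a i) + 2 * (u i * vec_inner (a i) (b l))
        + u i * vec_inner (b l) (b l))"
      unfolding sum_distrib_right
    proof (rule sum.cong[OF refl])
      show "u i * \<tau> = u i * vec_inner (a i) (a i) + 2 * (u i * vec_inner (a i) (b l))
          + u i * vec_inner (b l) (b l)" for i
        unfolding eq[of i l, symmetric] by (simp add: algebra_simps)
    qed
    also have "\<dots> = \<alpha>\<^sub>0 + vec_inner (b l) (b l)"
      by (simp add: sum.distrib sum_distrib_left[symmetric] sum_distrib_right[symmetric] ua' u \<alpha>\<^sub>0_def)
    finally show ?thesis by simp
  qed
  have a: "vec_inner (a i) (a i) = \<tau> - \<beta>\<^sub>0" for i
  proof -
    have "\<tau> = (\<Sum>l\<in>UNIV. v l) * \<tau>" by (simp add: v)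
    also have "\<dots> = (\<Sum>l\<in>UNIV. v l * vec_inner (a i) (a i) + 2 * (v l * vec_inner (a i) (b l))
        + v l * vec_inner (b l) (b l))"
      unfolding sum_distrib_right
    proof (rule sum.cong[OF refl])
      show "v l * \<tau> = v l * vec_inner (a i) (a i) + 2 * (v l * vec_inner (a i) (b l))
          + v l * vec_inner (b l) (b l)" for l
        unfolding eq[of i l, symmetric] by (simp add: algebra_simps)
    qed
    also have "\<dots> = vec_inner (a i) (a i) + \<beta>\<^sub>0"
      by (simp add: sum.distrib sum_distrib_left[symmetric] sum_distrib_right[symmetric] vb' v \<beta>\<^sub>0_def)
    finally show ?thesis by simp
  qed
  have const: "vec_inner (a i) (b l) = (\<alpha>\<^sub>0 + \<beta>\<^sub>0 - \<tau>) / 2" for i l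
    using eq[of i l] a[of i] b[of l] by simp
  have "(\<alpha>\<^sub>0 + \<beta>\<^sub>0 - \<tau>) / 2 = 0"
    using ua'[of "b undefined", unfolded const sum_distrib_right[symmetric] u] by simp
  with a b const show ?thesis by metis
qed


lemma dual_laplacian_null_imp_constant:
  fixes G :: "'a::finite \<Rightarrow> 'a \<Rightarrow> bool" and p :: "'a \<Rightarrow> rvec"
  assumes G: "simple_graph G" and B: "dual_optimal G B" and conn: "connected_matrix B"
    and null: "\<And>i. (\<Sum>j\<in>UNIV. ((if i = j then (vector_chromatic_number G - 1) * B $ i $ i else 0)
      - (if i = j then 0 else B $ i $ j)) *\<^sub>R p j) = 0"
  shows "p i = p j"
proof (rule laplacian_null_imp_constant[OF _ _ dual_optimal_off_diagonal_row_sum[OF G B] _ null])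
  have feas: "dual_feasible G B" using B by (simp add: dual_optimal_def)
  show "(if i = j then 0 else B $ i $ j) = (if j = i then 0 else B $ j $ i)" for i j
    using psd_kernel_sym[OF dual_feasible_psd_kernel[OF feas]] by simp
  show "0 \<le> (if i = j then 0 else B $ i $ j)" for i j
    using feas by (simp add: dual_feasible_def)
  have "(\<lambda>i j. (if i = j then 0 else B $ i $ j) \<noteq> 0) = (\<lambda>i j. i \<noteq> j \<and> B $ i $ j \<noteq> 0)"
    by (auto simp: fun_eq_iff)
  then show "connected_graph (\<lambda>i j. (if i = j then 0 else B $ i $ j) \<noteq> 0)"
    using conn by (simp add: connected_matrix_def)
qed

text \<open>Without off-diagonal entries the row sums would force a zero diagonal, against trace 1.
  The resulting tight edge serves as the reference for splitting the weight between the
  factors.\<close>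

lemma dual_optimal_support_edge:
  assumes G: "simple_graph G" "nonempty_graph G" and B: "dual_optimal G B"
  shows "\<exists>i j. i \<noteq> j \<and> B $ i $ j \<noteq> 0"
proof (rule ccontr)
  assume none: "\<not> ?thesis"
  then have "(\<Sum>j\<in>UNIV. if i = j then 0 else B $ i $ j) = 0" for i
    by (intro sum.neutral) auto
  then have "B $ i $ i = 0" for i
    using dual_optimal_off_diagonal_row_sum[OF G(1) B] vector_chromatic_number_ge_2[OF G] by auto
  then show False using B by (simp add: dual_optimal_def dual_feasible_def trace_def)
qed

lemma connected_dual_imp_induced:
  fixes G :: "'a::finite \<Rightarrow> 'a \<Rightarrow> bool" and H :: "'b::finite \<Rightarrow> 'b \<Rightarrow> bool"
  assumes G: "simple_graph G" "nonempty_graph G" and H: "simple_graph H" "nonempty_graph H"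
    and eq: "vector_chromatic_number G = vector_chromatic_number H"
    and B: "dual_optimal G B" "connected_matrix B" and C: "dual_optimal H C" "connected_matrix C"
    and p: "optimal_vector_coloring (categorical_product G H) p"
  shows "convex_combination_of_induced G H p"
proof -
  define t where "t = vector_chromatic_number H"
  have t: "vector_chromatic_number G = t" "vector_chromatic_number H = t"
    using eq by (simp_all add: t_def)
  have t2: "2 \<le> t" using vector_chromatic_number_ge_2[OF G] t by simp
  have feasB: "dual_feasible G B" and feasC: "dual_feasible H C"
    using B C by (simp_all add: dual_optimal_def)
  have trB: "(\<Sum>i\<in>UNIV. B $ i $ i) = 1" and trC: "(\<Sum>l\<in>UNIV. C $ l $ l) = 1"
    using feasB feasC by (simp_all add: dual_feasible_def trace_def)
  have rowB: "(\<Sum>j\<in>UNIV. B $ i $ j) = t * B $ i $ i" for i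
    using dual_optimal_row_sum[OF G(1) B(1)] t by simp
  have rowC: "(\<Sum>k\<in>UNIV. C $ l $ k) = t * C $ l $ l" for l
    using dual_optimal_row_sum[OF H(1) C(1)] t by simp
  have colB: "(\<Sum>i\<in>UNIV. B $ i $ j) = t * B $ j $ j" for j
    unfolding rowB[symmetric]
    by (rule sum.cong[OF refl psd_kernel_sym[OF dual_feasible_psd_kernel[OF feasB]]])
  have colC: "(\<Sum>l\<in>UNIV. C $ l $ k) = t * C $ k $ k" for k
    unfolding rowC[symmetric]
    by (rule sum.cong[OF refl psd_kernel_sym[OF dual_feasible_psd_kernel[OF feasC]]])
  note null = product_coloring_null[OF G H(1) t B(1) C(1) p]
  have additive: "p (i, l) + p (j, k) = p (i, k) + p (j, l)" for i j l k
  proof -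
    define L where "L i j = (if i = j then (t - 1) * B $ i $ i else 0) - (if i = j then 0 else B $ i $ j)" for i j
    define L' where "L' l k = (if l = k then (t - 1) * C $ l $ l else 0) - (if l = k then 0 else C $ l $ k)" for l k
    show ?thesis
    proof (rule laplacian_product_null_imp_additive[of L L' "\<lambda>i l. p (i, l)"])
      show "(\<Sum>j\<in>UNIV. \<Sum>k\<in>UNIV. (L i j * L' l k) *\<^sub>R p (j, k)) = 0" for i l
        unfolding L_def L'_def by (rule null(3))
      show "f i = f j" if "\<And>i. (\<Sum>j\<in>UNIV. L i j *\<^sub>R (f j :: rvec)) = 0" for f i j
        by (rule dual_laplacian_null_imp_constant[OF G(1) B, unfolded t], rule that[unfolded L_def])
      show "f l = f k" if "\<And>l. (\<Sum>k\<in>UNIV. L' l k *\<^sub>R (f k :: rvec)) = 0" for f l k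
        by (rule dual_laplacian_null_imp_constant[OF H(1) C, unfolded t], rule that[unfolded L'_def])
    qed
  qed
  define a where "a i = (\<Sum>k\<in>UNIV. C $ k $ k *\<^sub>R p (i, k))" for i
  define b where "b l = (\<Sum>j\<in>UNIV. B $ j $ j *\<^sub>R p (j, l))" for l
  have Ba: "(\<Sum>j\<in>UNIV. B $ i $ j *\<^sub>R a j) = 0" for i
    unfolding a_def
    by (rule marginal_null[of "\<lambda>i j. B $ i $ j" "\<lambda>l k. C $ l $ k" "\<lambda>i l. p (i, l)", OF null(2) colC])
      (use t2 in simp)
  have Cb: "(\<Sum>k\<in>UNIV. C $ l $ k *\<^sub>R b k) = 0" for l
    unfolding b_def
  proof (rule marginal_null[of "\<lambda>l k. C $ l $ k" "\<lambda>i j. B $ i $ j" "\<lambda>l i. p (i, l)", OF _ colB])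
    show "(\<Sum>k\<in>UNIV. \<Sum>j\<in>UNIV. (C $ l $ k * B $ i $ j) *\<^sub>R p (j, k)) = 0" for l i
      using null(2)[of i l] by (subst sum.swap) (simp add: mult.commute)
  qed (use t2 in simp)
  have Da: "(\<Sum>j\<in>UNIV. B $ j $ j *\<^sub>R a j) = 0"
  proof -
    have "0 = (\<Sum>i\<in>UNIV. \<Sum>j\<in>UNIV. B $ i $ j *\<^sub>R a j)" by (simp add: Ba)
    also have "\<dots> = (\<Sum>j\<in>UNIV. (t * B $ j $ j) *\<^sub>R a j)"
      by (subst sum.swap) (simp add: scaleR_left.sum[symmetric] colB)
    also have "\<dots> = t *\<^sub>R (\<Sum>j\<in>UNIV. B $ j $ j *\<^sub>R a j)" by (simp add: scaleR_sum_right)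
    finally show ?thesis using t2 by simp
  qed
  have Db: "(\<Sum>k\<in>UNIV. C $ k $ k *\<^sub>R b k) = 0"
  proof -
    have "0 = (\<Sum>l\<in>UNIV. \<Sum>k\<in>UNIV. C $ l $ k *\<^sub>R b k)" by (simp add: Cb)
    also have "\<dots> = (\<Sum>k\<in>UNIV. (t * C $ k $ k) *\<^sub>R b k)"
      by (subst sum.swap) (simp add: scaleR_left.sum[symmetric] colC)
    also have "\<dots> = t *\<^sub>R (\<Sum>k\<in>UNIV. C $ k $ k *\<^sub>R b k)" by (simp add: scaleR_sum_right)
    finally show ?thesis using t2 by simp
  qed
  have p_eq: "p (i, l) = a i + b l" for i l
    using additive_marginals[of "\<lambda>i l. p (i, l)", OF additive trB trC, of i l] Da
    unfolding a_def b_def by simp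
  have p_col: "vector_coloring (categorical_product G H) t p"
    using p null(1) by (simp add: optimal_vector_coloring_def)
  then have p_diag: "vec_inner (a i + b l) (a i + b l) = t - 1" for i l
    unfolding vector_coloring_def p_eq[symmetric] by blast
  obtain \<alpha> \<beta> where \<alpha>: "\<And>i. vec_inner (a i) (a i) = \<alpha>" and \<beta>: "\<And>l. vec_inner (b l) (b l) = \<beta>"
    and orth: "\<And>i l. vec_inner (a i) (b l) = 0"
    using centered_sum_orthogonal[OF trB trC Da Db p_diag] by blast
  have R: "vec_inner (p (i, l)) (p (j, k)) = vec_inner (a i) (a j) + vec_inner (b l) (b k)" for i j l k
    by (simp add: p_eq vec_inner_add_left vec_inner_add_right orth vec_inner_commute[of "b l" "a j"])
  obtain i0 j0 where ij0: "i0 \<noteq> j0" "B $ i0 $ j0 \<noteq> 0"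
    using dual_optimal_support_edge[OF G B(1)] by blast
  obtain l0 k0 where lk0: "l0 \<noteq> k0" "C $ l0 $ k0 \<noteq> 0"
    using dual_optimal_support_edge[OF H C(1)] by blast
  have edge0: "G i0 j0" "H l0 k0"
    using ij0 lk0 feasB feasC unfolding dual_feasible_def by blast+
  \<comment> \<open>By \<open>slack\<close> the inner products of \<open>a\<close> along support
    edges of \<open>B\<close> all agree, and likewise those of \<open>b\<close> for
    \<open>C\<close>, so one edge of each support determines the two weights.\<close>
  define c where "c = - vec_inner (a i0) (a j0)"
  define d where "d = - vec_inner (b l0) (b k0)"
  have slack: "vec_inner (a i) (a j) + vec_inner (b l) (b k) = -1"
    if "i \<noteq> j" "B $ i $ j \<noteq> 0" "l \<noteq> k" "C $ l $ k \<noteq> 0" for i j l k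
    using null(4)[OF that] by (simp add: R)
  have cd: "c + d = 1" using slack[OF ij0 lk0] by (simp add: c_def d_def)
  have "\<alpha> = c * (t - 1)"
  proof (rule null_vectors_norm[OF trB _ Ba \<alpha>])
    show "(\<Sum>i\<in>UNIV. \<Sum>j\<in>UNIV. B $ i $ j) = t"
      by (simp add: rowB sum_distrib_left[symmetric] trB)
    show "vec_inner (a i) (a j) = - c" if "i \<noteq> j" "B $ i $ j \<noteq> 0" for i j
      using slack[OF that lk0] cd by (simp add: d_def)
  qed
  have "\<beta> = d * (t - 1)"
  proof (rule null_vectors_norm[OF trC _ Cb \<beta>])
    show "(\<Sum>l\<in>UNIV. \<Sum>k\<in>UNIV. C $ l $ k) = t"
      by (simp add: rowC sum_distrib_left[symmetric] trC)
    show "vec_inner (b l) (b k) = - d" if "l \<noteq> k" "C $ l $ k \<noteq> 0" for l k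
      using slack[OF ij0 that] cd by (simp add: c_def)
  qed
  have c0: "0 \<le> c" "0 \<le> d"
    using vec_inner_self_nonneg[of "a i0"] vec_inner_self_nonneg[of "b l0"] t2
    by (auto simp: \<alpha> \<beta> \<open>\<alpha> = c * (t - 1)\<close> \<open>\<beta> = d * (t - 1)\<close> zero_le_mult_iff)
  have edge: "vec_inner (a i) (a j) + vec_inner (b l) (b k) \<le> -1" if "G i j" "H l k" for i j l k
    using p_col that unfolding vector_coloring_def R[symmetric] by (simp add: categorical_product_def)
  have irr: "irreflp G" "irreflp H" using G(1) H(1) by (simp_all add: simple_graph_def)
  obtain q where q: "optimal_vector_coloring G q"
    and aq: "\<And>i j. vec_inner (a i) (a j) = c * vec_inner (q i) (q j)"
  proof -
    \<comment> \<open>Pairing an edge of \<open>G\<close> with the tight edge of \<open>H\<close>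
      turns the product constraint into one on \<open>a\<close> alone.\<close>
    have "vec_inner (a i) (a j) \<le> - c" if "G i j" for i j
      using edge[OF that edge0(2)] cd by (simp add: d_def)
    then show ?thesis
      using scaled_optimal_coloring[OF irr(1) c0(1), of a] that \<alpha> \<open>\<alpha> = c * (t - 1)\<close> t by auto
  qed
  obtain r where r: "optimal_vector_coloring H r"
    and br: "\<And>l k. vec_inner (b l) (b k) = d * vec_inner (r l) (r k)"
  proof -
    have "vec_inner (b l) (b k) \<le> - d" if "H l k" for l k
      using edge[OF edge0(1) that] cd by (simp add: c_def)
    then show ?thesis
      using scaled_optimal_coloring[OF irr(2) c0(2), of b] that \<beta> \<open>\<beta> = d * (t - 1)\<close> t by auto
  qed
  have "gram p = c *\<^sub>R kronecker (gram q) all_ones + d *\<^sub>R kronecker all_ones (gram r)"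
    by (auto simp: vec_eq_iff gram_def kronecker_def all_ones_def R aq br)
  then show ?thesis
    unfolding convex_combination_of_induced_def using p_col c0 cd q r by blast
qed


section \<open>Disconnected skeletons\<close>

lemma psd_kernel_sum:
  assumes "\<And>e. e \<in> E \<Longrightarrow> psd_kernel (K e)"
  shows "psd_kernel (\<lambda>i j. \<Sum>e\<in>E. K e i j)"
  using assms
proof (induction E rule: infinite_finite_induct)
  case (insert e E)
  then show ?case by (simp add: psd_kernel_add)
qed (simp_all add: psd_kernel_def quad_form_def)

text \<open>Each non-skeleton edge has its own optimal coloring with slack. Averaging the Gram
  matrices over all pairs stays optimal and keeps every one of these strict inequalities.\<close>

lemma optimal_coloring_strict_off_skeleton:
  fixes G :: "'a::finite \<Rightarrow> 'a \<Rightarrow> bool"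
  assumes "irreflp G"
  shows "\<exists>q. optimal_vector_coloring G q \<and>
    (\<forall>i j. G i j \<and> \<not> skeleton G i j \<longrightarrow> vec_inner (q i) (q j) < -1)"
proof -
  define t where "t = vector_chromatic_number G"
  have "\<exists>q. optimal_vector_coloring G q \<and>
      (G (fst e) (snd e) \<and> \<not> skeleton G (fst e) (snd e) \<longrightarrow> vec_inner (q (fst e)) (q (snd e)) < -1)" for e
  proof (cases "G (fst e) (snd e) \<and> \<not> skeleton G (fst e) (snd e)")
    case True
    then obtain q where "optimal_vector_coloring G q" "vec_inner (q (fst e)) (q (snd e)) \<noteq> -1"
      unfolding skeleton_def by blast
    then show ?thesis
      using True unfolding optimal_vector_coloring_def vector_coloring_def by force
  next
    case False
    then show ?thesis using optimal_vector_coloring_exists(1)[OF assms] by blast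
  qed
  then obtain Q where Q: "\<And>e. optimal_vector_coloring G (Q e)"
    and Q_strict: "\<And>i j. G i j \<Longrightarrow> \<not> skeleton G i j \<Longrightarrow> vec_inner (Q (i, j) i) (Q (i, j) j) < -1"
    by (metis fst_conv snd_conv)
  define N where "N = real CARD('a \<times> 'a)"
  have N: "0 < N" by (simp add: N_def)
  define M where "M i j = (1 / N) * (\<Sum>e\<in>UNIV. vec_inner (Q e i) (Q e j))" for i j
  have "psd_kernel M"
    unfolding M_def using N by (intro psd_kernel_scale psd_kernel_sum psd_kernel_gram) simp
  then obtain q where q: "\<And>i j. vec_inner (q i) (q j) = M i j"
    using psd_kernel_factorization by blast
  have Q_diag: "vec_inner (Q e i) (Q e i) = t - 1" and Q_edge: "G i j \<Longrightarrow> vec_inner (Q e i) (Q e j) \<le> -1"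
    for e i j
    using Q[of e] unfolding optimal_vector_coloring_def vector_coloring_def t_def by auto
  have sum_N: "(\<Sum>e\<in>(UNIV :: ('a \<times> 'a) set). x) = N * x" for x :: real by (simp add: N_def)
  have "M i i = t - 1" for i unfolding M_def Q_diag sum_N using N by simp
  moreover have "M i j \<le> -1" if "G i j" for i j
  proof -
    have "(\<Sum>e\<in>UNIV. vec_inner (Q e i) (Q e j)) \<le> (\<Sum>e\<in>(UNIV :: ('a \<times> 'a) set). -1)"
      by (intro sum_mono Q_edge that)
    then show ?thesis unfolding M_def sum_N using N by (simp add: divide_le_eq)
  qed
  moreover have "1 \<le> t"
    using Q unfolding optimal_vector_coloring_def vector_coloring_def t_def by blast
  ultimately have "optimal_vector_coloring G q"
    unfolding optimal_vector_coloring_def vector_coloring_def by (simp add: q t_def)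
  moreover have "M i j < -1" if "G i j" "\<not> skeleton G i j" for i j
  proof -
    have "(\<Sum>e\<in>UNIV. vec_inner (Q e i) (Q e j)) < (\<Sum>e\<in>(UNIV :: ('a \<times> 'a) set). -1)"
      by (rule sum_strict_mono_ex1) (auto intro!: Q_edge that bexI[of _ "(i, j)"] Q_strict)
    then show ?thesis unfolding M_def sum_N using N by (simp add: divide_less_eq)
  qed
  ultimately show ?thesis using q by auto
qed

text \<open>The product equation makes the bound on a crossing edge come out as exactly -1. It puts
  \<open>x * y\<close> below 1/2, hence the two weights differ.\<close>

lemma unequal_unit_weights:
  assumes "0 < (\<delta>::real)"
  shows "\<exists>x y. 0 \<le> x \<and> 0 \<le> y \<and> x\<^sup>2 + y\<^sup>2 = 1 \<and> (2 + \<delta>) * (x * y) = 1 \<and> x\<^sup>2 \<noteq> y\<^sup>2"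
proof -
  define m where "m = 1 / (2 + \<delta>)"
  have m: "0 < m" "2 * m < 1" "(2 + \<delta>) * m = 1" using assms by (auto simp: m_def field_simps)
  \<comment> \<open>These are \<open>x + y\<close> and \<open>x - y\<close>, whose squares are
    determined by the sum of squares and the product.\<close>
  define u v where "u = sqrt (1 + 2 * m)" and "v = sqrt (1 - 2 * m)"
  have uv: "u\<^sup>2 = 1 + 2 * m" "v\<^sup>2 = 1 - 2 * m" "0 < v" "0 < u" "v \<le> u"
    using m by (simp_all add: u_def v_def)
  have "((u + v) / 2) * ((u - v) / 2) = (u\<^sup>2 - v\<^sup>2) / 4"
    and "((u + v) / 2)\<^sup>2 + ((u - v) / 2)\<^sup>2 = (u\<^sup>2 + v\<^sup>2) / 2"
    and "((u + v) / 2)\<^sup>2 - ((u - v) / 2)\<^sup>2 = u * v"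
    by (simp_all add: power2_eq_square field_simps)
  moreover have "u * v \<noteq> 0" using uv by simp
  ultimately show ?thesis
    using uv m by (intro exI[of _ "(u + v) / 2"] exI[of _ "(u - v) / 2"]) auto
qed

text \<open>If no skeleton edge leaves \<open>S\<close>, the coloring \<open>(x q\<^sub>i, y r\<^sub>l)\<close> for \<open>i \<in> S\<close> and \<open>(y q\<^sub>i, x r\<^sub>l)\<close> for
  \<open>i \<notin> S\<close> is admissible for suitable \<open>x \<noteq> y\<close>: the loss on edges leaving \<open>S\<close> is paid for by the slack
  of \<open>q\<close>. Its Gram matrix is not additive.\<close>

lemma additive_gram_imp_skeleton_connected:
  fixes G :: "'a::finite \<Rightarrow> 'a \<Rightarrow> bool" and H :: "'b::finite \<Rightarrow> 'b \<Rightarrow> bool"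
  assumes G: "simple_graph G" and H: "simple_graph H" "nonempty_graph H"
    and t: "vector_chromatic_number G = t" "vector_chromatic_number H = t"
    and additive: "\<And>p. vector_coloring (categorical_product G H) t p \<Longrightarrow>
      \<exists>M N. \<forall>i l j k. vec_inner (p (i, l)) (p (j, k)) = M i j + N l k"
  shows "connected_graph (skeleton G)"
proof (rule ccontr)
  assume "\<not> ?thesis"
  then obtain i0 j0 where "\<not> (skeleton G)\<^sup>*\<^sup>* i0 j0" unfolding connected_graph_def by blast
  define S where "S = {i. (skeleton G)\<^sup>*\<^sup>* i0 i}"
  have i0: "i0 \<in> S" and j0: "j0 \<notin> S" using \<open>\<not> (skeleton G)\<^sup>*\<^sup>* i0 j0\<close> by (simp_all add: S_def)
  have "skeleton G j i" if "skeleton G i j" for i j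
    using that G unfolding skeleton_def simple_graph_def by (metis sympD vec_inner_commute)
  moreover have "skeleton G i j \<Longrightarrow> i \<in> S \<Longrightarrow> j \<in> S" for i j
    unfolding S_def by (auto intro: rtranclp.rtrancl_into_rtrancl)
  ultimately have cross: "\<not> skeleton G i j" if "(i \<in> S) \<noteq> (j \<in> S)" for i j using that by blast
  have irr: "irreflp G" "irreflp H" using G H by (simp_all add: simple_graph_def)
  obtain q where q: "optimal_vector_coloring G q"
    and q_strict: "\<And>i j. G i j \<Longrightarrow> \<not> skeleton G i j \<Longrightarrow> vec_inner (q i) (q j) < -1"
    using optimal_coloring_strict_off_skeleton[OF irr(1)] by blast
  obtain r where r: "optimal_vector_coloring H r"
    using optimal_vector_coloring_exists(1)[OF irr(2)] by blast
  have q_diag: "vec_inner (q i) (q i) = t - 1" and q_edge: "G i j \<Longrightarrow> vec_inner (q i) (q j) \<le> -1" for i j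
    using q t unfolding optimal_vector_coloring_def vector_coloring_def by auto
  have r_diag: "vec_inner (r l) (r l) = t - 1" and r_edge: "H l k \<Longrightarrow> vec_inner (r l) (r k) \<le> -1" for l k
    using r t unfolding optimal_vector_coloring_def vector_coloring_def by auto
  \<comment> \<open>The extra element 1 keeps the minimum defined and positive when every edge lies
    in the skeleton.\<close>
  define X where "X = insert 1 ((\<lambda>(i, j). -1 - vec_inner (q i) (q j)) ` {(i, j). G i j \<and> \<not> skeleton G i j})"
  define \<delta> where "\<delta> = Min X"
  have X: "finite X" "X \<noteq> {}" by (simp_all add: X_def)
  then have \<delta>: "0 < \<delta>"
    unfolding \<delta>_def by (subst Min_gr_iff) (auto simp: X_def dest: q_strict)
  have slack: "vec_inner (q i) (q j) \<le> -1 - \<delta>" if "G i j" "(i \<in> S) \<noteq> (j \<in> S)" for i j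
  proof -
    have "-1 - vec_inner (q i) (q j) \<in> X" using that cross by (force simp: X_def)
    then have "\<delta> \<le> -1 - vec_inner (q i) (q j)" unfolding \<delta>_def using X(1) by (rule Min_le[rotated])
    then show ?thesis by simp
  qed
  obtain x y :: real where xy: "0 \<le> x" "0 \<le> y" "x\<^sup>2 + y\<^sup>2 = 1" "(2 + \<delta>) * (x * y) = 1" "x\<^sup>2 \<noteq> y\<^sup>2"
    using unequal_unit_weights[OF \<delta>] by blast
  define w where "w i = (if i \<in> S then x else y)" for i
  define z where "z i = (if i \<in> S then y else x)" for i
  have wz: "(w i)\<^sup>2 + (z i)\<^sup>2 = 1" for i using xy(3) by (simp add: w_def z_def add.commute)
  define K where "K e f = vec_inner (w (fst e) *\<^sub>R q (fst e)) (w (fst f) *\<^sub>R q (fst f))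
      + vec_inner (z (fst e) *\<^sub>R r (snd e)) (z (fst f) *\<^sub>R r (snd f))" for e f
  have "psd_kernel K" unfolding K_def by (rule psd_kernel_add[OF psd_kernel_gram psd_kernel_gram])
  then obtain p where p: "\<And>e f. vec_inner (p e) (p f) = K e f"
    using psd_kernel_factorization by blast
  have K: "K (i, l) (j, k) = w i * w j * vec_inner (q i) (q j) + z i * z j * vec_inner (r l) (r k)"
    for i j l k by (simp add: K_def vec_inner_scaleR_left vec_inner_scaleR_right mult.assoc)
  have K_diag: "K (i, l) (i, l) = t - 1" for i l
    using arg_cong[OF wz[of i], of "\<lambda>v. v * (t - 1)"]
    by (simp add: K q_diag r_diag power2_eq_square algebra_simps)
  have "K (i, l) (j, k) \<le> -1" if e: "G i j" "H l k" for i j l k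
  proof (cases "(i \<in> S) = (j \<in> S)")
    case True
    then have "w j = w i" "z j = z i" by (simp_all add: w_def z_def)
    moreover have "(w i)\<^sup>2 * vec_inner (q i) (q j) \<le> (w i)\<^sup>2 * (-1)"
      "(z i)\<^sup>2 * vec_inner (r l) (r k) \<le> (z i)\<^sup>2 * (-1)"
      by (intro mult_left_mono q_edge r_edge e; simp)+
    ultimately show ?thesis using wz[of i] by (simp add: K power2_eq_square)
  next
    case False
    then have "w i * w j = x * y" "z i * z j = x * y" by (auto simp: w_def z_def)
    moreover have "(x * y) * vec_inner (q i) (q j) \<le> (x * y) * (-1 - \<delta>)"
      "(x * y) * vec_inner (r l) (r k) \<le> (x * y) * (-1)"
      using slack[OF e(1) False] r_edge[OF e(2)] xy by (intro mult_left_mono; simp)+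
    moreover have "(x * y) * (-1 - \<delta>) + (x * y) * (-1) = -1"
      using xy(4) by (simp add: algebra_simps)
    ultimately show ?thesis unfolding K by simp
  qed
  moreover have "1 \<le> t"
    using q t unfolding optimal_vector_coloring_def vector_coloring_def by auto
  ultimately have "vector_coloring (categorical_product G H) t p"
    using K_diag by (auto simp: vector_coloring_def categorical_product_def p)
  from additive[OF this] obtain M N where "\<And>i l j k. vec_inner (p (i, l)) (p (j, k)) = M i j + N l k"
    by blast
  then have MN: "K (i, l) (j, k) = M i j + N l k" for i l j k by (simp add: p)
  obtain l k where lk: "H l k" using H(2) unfolding nonempty_graph_def by blast
  \<comment> \<open>Fixing the \<open>G\<close>-index cancels \<open>M\<close>, so additivity would
    make the squared weight \<open>z i\<close> independent of \<open>i\<close>.\<close>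
  have "(z i)\<^sup>2 * (t - 1 - vec_inner (r l) (r k)) = N l l - N l k" for i
    using MN[of i l i l] MN[of i l i k] unfolding K q_diag r_diag
    by (simp add: power2_eq_square algebra_simps)
  then have "(z i0)\<^sup>2 * (t - 1 - vec_inner (r l) (r k)) = (z j0)\<^sup>2 * (t - 1 - vec_inner (r l) (r k))"
    by simp
  moreover have "t - 1 - vec_inner (r l) (r k) \<noteq> 0" using r_edge[OF lk] \<open>1 \<le> t\<close> by simp
  ultimately show False using xy(5) i0 j0 by (simp add: z_def)
qed

theorem mainTheorem11:
  fixes G :: "'a::finite \<Rightarrow> 'a \<Rightarrow> bool" and H :: "'b::finite \<Rightarrow> 'b \<Rightarrow> bool"
  assumes "simple_graph G" and "simple_graph H"
    and "nonempty_graph G" and "nonempty_graph H"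
    and "vector_chromatic_number G = vector_chromatic_number H"
  shows "((\<exists>B. strictly_complementary G B \<and> connected_matrix B) \<and>
          (\<exists>C. strictly_complementary H C \<and> connected_matrix C)
            \<longrightarrow> (\<forall>p. optimal_vector_coloring (categorical_product G H) p
                     \<longrightarrow> convex_combination_of_induced G H p))
       \<and> ((\<forall>p. optimal_vector_coloring (categorical_product G H) p
                 \<longrightarrow> convex_combination_of_induced G H p)
            \<longrightarrow> connected_graph (skeleton G) \<and> connected_graph (skeleton H))"
proof (rule conjI; rule impI)
  assume "(\<exists>B. strictly_complementary G B \<and> connected_matrix B) \<and>
    (\<exists>C. strictly_complementary H C \<and> connected_matrix C)"
  then show "\<forall>p. optimal_vector_coloring (categorical_product G H) p \<longrightarrow>
      convex_combination_of_induced G H p"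
    using connected_dual_imp_induced[OF assms(1,3,2,4,5)] unfolding strictly_complementary_def by blast
next
  assume induced: "\<forall>p. optimal_vector_coloring (categorical_product G H) p \<longrightarrow>
    convex_combination_of_induced G H p"
  define t where "t = vector_chromatic_number H"
  have t: "vector_chromatic_number G = t" "vector_chromatic_number H = t"
    using assms(5) by (simp_all add: t_def)
  have gram: "\<exists>M N \<alpha> \<beta>. (\<forall>i l j k. vec_inner (p (i, l)) (p (j, k)) = \<alpha> * M i j + \<beta> * N l k)
      \<and> \<alpha> + \<beta> = 1 \<and> (\<forall>i. M i i = t - 1) \<and> (\<forall>l. N l l = t - 1)"
    if p: "optimal_vector_coloring (categorical_product G H) p" for p
  proof -
    from induced p obtain \<alpha> \<beta> q r where "\<alpha> + \<beta> = 1"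
      and q: "optimal_vector_coloring G q" and r: "optimal_vector_coloring H r"
      and eq: "gram p = \<alpha> *\<^sub>R kronecker (gram q) all_ones + \<beta> *\<^sub>R kronecker all_ones (gram r)"
      unfolding convex_combination_of_induced_def by blast
    have "vec_inner (p (i, l)) (p (j, k)) = \<alpha> * vec_inner (q i) (q j) + \<beta> * vec_inner (r l) (r k)"
      for i l j k
      using arg_cong[OF eq, of "\<lambda>A. A $ (i, l) $ (j, k)"]
      by (simp add: gram_def kronecker_def all_ones_def)
    with \<open>\<alpha> + \<beta> = 1\<close> q r t show ?thesis
      unfolding optimal_vector_coloring_def vector_coloring_def
      by (intro exI[of _ "\<lambda>i j. vec_inner (q i) (q j)"] exI[of _ "\<lambda>l k. vec_inner (r l) (r k)"]
          exI[of _ \<alpha>] exI[of _ \<beta>]) simp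
  qed
  have "irreflp (categorical_product G H)"
    using assms(1) by (auto simp: simple_graph_def irreflp_def categorical_product_def)
  then obtain p where p: "optimal_vector_coloring (categorical_product G H) p"
    using optimal_vector_coloring_exists(1) by blast
  \<comment> \<open>An induced Gram matrix has diagonal
    \<open>(\<alpha> + \<beta>) * (t - 1)\<close>, so the value is read off from any optimal
    coloring of the product.\<close>
  have "vector_chromatic_number (categorical_product G H) = t"
  proof -
    fix i :: 'a and l :: 'b
    obtain \<alpha> \<beta> where "vec_inner (p (i, l)) (p (i, l)) = \<alpha> * (t - 1) + \<beta> * (t - 1)" "\<alpha> + \<beta> = 1"
      using gram[OF p] by metis
    then have "vec_inner (p (i, l)) (p (i, l)) = t - 1"
      by (metis distrib_right mult_1)
    moreover have "vec_inner (p (i, l)) (p (i, l)) = vector_chromatic_number (categorical_product G H) - 1"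
      using p unfolding optimal_vector_coloring_def vector_coloring_def by blast
    ultimately show ?thesis by simp
  qed
  then have additive: "\<exists>M N. \<forall>i l j k. vec_inner (p (i, l)) (p (j, k)) = M i j + N l k"
    if "vector_coloring (categorical_product G H) t p" for p
  proof -
    have "optimal_vector_coloring (categorical_product G H) p"
      using that \<open>vector_chromatic_number (categorical_product G H) = t\<close>
      by (simp add: optimal_vector_coloring_def)
    from gram[OF this] obtain M N \<alpha> \<beta>
      where "\<forall>i l j k. vec_inner (p (i, l)) (p (j, k)) = \<alpha> * M i j + \<beta> * N l k" by blast
    then show ?thesis
      by (intro exI[of _ "\<lambda>i j. \<alpha> * M i j"] exI[of _ "\<lambda>l k. \<beta> * N l k"])
  qed
  have "connected_graph (skeleton G)"
    by (rule additive_gram_imp_skeleton_connected[OF assms(1,2,4) t additive])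
  moreover have "connected_graph (skeleton H)"
  \<comment> \<open>Additivity of the Gram matrix is symmetric in the two factors, so swapping
    coordinates transfers it to the reversed product.\<close>
  proof (rule additive_gram_imp_skeleton_connected[OF assms(2,1,3) t(2,1)])
    fix p assume "vector_coloring (categorical_product H G) t p"
    then have "vector_coloring (categorical_product G H) t (\<lambda>(i, l). p (l, i))"
      by (auto simp: vector_coloring_def categorical_product_def)
    from additive[OF this] obtain M N
      where "\<forall>i l j k. vec_inner (p (l, i)) (p (k, j)) = M i j + N l k" by auto
    then show "\<exists>M N. \<forall>i l j k. vec_inner (p (i, l)) (p (j, k)) = M i j + N l k"
      by (intro exI[of _ N] exI[of _ M]) (simp add: add.commute)
  qed
  ultimately show "connected_graph (skeleton G) \<and> connected_graph (skeleton H)" ..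
qed

end
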